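(* For any $v\in [H_0^2(\Omega)]^2$, there holds \[ C(\Omega)\left(\|v\|_{H^1}^2+\iota^2|v|_{H^2}^2\right)\le a(v,v)\le 2(\lambda+\mu)\left(\|v\|_{H^1}^2+\iota^2|v|_{H^2}^2\right), \] where $C(\Omega)>0$ depends only on $\mu$ and on the constant $C_p$ in the Poincaré inequality $\|v\|_{L^2}\le C_p\|\nabla v\|_{L^2}$.
   Context: $\Omega\subset\mathbb R^2$ is a bounded polygon; all norms are over $\Omega$. $\lambda$ and $\mu$ are the Lamé constants, and $\iota$ is the microscopic parameter, with $0<\iota\le 1$. $(\cdot,\cdot)$ and $\|\cdot\|_{L^2}$ are the $L^2(\Omega)$ inner product and norm (of scalars, vectors or tensors). For scalar $v$, $\|v\|_{H^m}^2=\sum_{k=0}^m|v|_{H^k}^2$ and $|v|_{H^k}^2=\int_\Omega\sum_{|\alpha|=k}|\nabla^\alpha v|^2\,dx$, where $\alpha=(\alpha_1,\alpha_2)$ is a multi-index with nonnegative integer components, $|\alpha|=\alpha_1+\alpha_2$ and $\nabla^\alpha=\partial^{|\alpha|}/\partial x_1^{\alpha_1}\partial x_2^{\alpha_2}$; for vector fields the spaces and norms are defined in a similar manner, componentwise. $H_0^m(\Omega)$ is the closure of $C_0^\infty(\Omega)$ in the Sobolev space $H^m(\Omega)$. For a vector field $v=(v_1,v_2)$, $(\nabla v)_{ij}=\partial v_i/\partial x_j$, $\epsilon(v)=\frac12(\nabla v+[\nabla v]^T)$, and $\nabla\epsilon(v)$ is the third-order tensor $(\nabla\epsilon(v))_{ijk}=\partial\epsilon_{jk}(v)/\partial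 x_i$. The bilinear form is \[ a(u,v)=(\mathbb C\epsilon(u),\epsilon(v))+(\mathbb D\nabla\epsilon(u),\nabla\epsilon(v)), \] where (summing over repeated indices) $(\mathbb C\epsilon)_{ij}=\mathbb C_{ijkl}\epsilon_{kl}$, $(\mathbb D\kappa)_{ijk}=\mathbb D_{ijklmn}\kappa_{lmn}$, and, with $\delta_{ij}$ the Kronecker delta, \[ \mathbb C_{ijkl}=\lambda\delta_{ij}\delta_{kl}+2\mu\delta_{ik}\delta_{jl},\qquad \mathbb D_{ijklmn}=\iota^2\left(\lambda\delta_{il}\delta_{jk}\delta_{mn}+2\mu\delta_{il}\delta_{jm}\delta_{kn}\right). \] Thus $a(v,v)=2\mu\|\epsilon(v)\|_{L^2}^2+\lambda\|\nabla\cdot v\|_{L^2}^2+\iota^2\left(2\mu\|\nabla\epsilon(v)\|_{L^2}^2+\lambda\|\nabla\nabla\cdot v\|_{L^2}^2\right)$.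
   Formalization: The Lamé constants are taken with μ > 0 and λ ≥ 0, and the upper bound is stated only for λ ≥ μ, since with the mixed derivative counted once in |v|_{H^2} it fails for every λ < μ (e.g. v = ∇(χ cos(k(x₁+x₂))), k large). *)

theory Defs
  imports "HOL-Analysis.Analysis"
begin

(* Open polygonal domain.  Holes are allowed; excluding degenerate segments rules out isolated
   boundary points. *)
definition bounded_polygon :: "(real^2) set \<Rightarrow> bool" where
  "bounded_polygon \<Omega> \<longleftrightarrow>
     \<Omega> \<noteq> {} \<and> open \<Omega> \<and> connected \<Omega> \<and> bounded \<Omega> \<and>
     (\<exists>S. finite S \<and> (\<forall>(a, b)\<in>S. a \<noteq> b) \<and> frontier \<Omega> = (\<Union>(a, b)\<in>S. closed_segment a b))"

definition partial :: "2 \<Rightarrow> (real^2 \<Rightarrow> real) \<Rightarrow> real^2 \<Rightarrow> real" where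
  "partial i f = (\<lambda>x. frechet_derivative f (at x) (axis i 1))"

primrec C_k :: "nat \<Rightarrow> (real^2 \<Rightarrow> real) \<Rightarrow> bool" where
  "C_k 0 f \<longleftrightarrow> continuous_on UNIV f"
| "C_k (Suc k) f \<longleftrightarrow> f differentiable_on UNIV \<and> (\<forall>i. C_k k (partial i f))"

(* C_0^infty(Omega); its members are extended by zero to the whole plane. *)
definition test_functions :: "(real^2) set \<Rightarrow> (real^2 \<Rightarrow> real) set" where
  "test_functions \<Omega> =
     {\<phi>. (\<forall>k. C_k k \<phi>) \<and> compact (closure {x. \<phi> x \<noteq> 0}) \<and> closure {x. \<phi> x \<noteq> 0} \<subseteq> \<Omega>}"

type_synonym multi_index = "nat \<times> nat"

definition ord_mi :: "multi_index \<Rightarrow> nat" where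
  "ord_mi \<alpha> = fst \<alpha> + snd \<alpha>"

definition multi_partial :: "multi_index \<Rightarrow> (real^2 \<Rightarrow> real) \<Rightarrow> real^2 \<Rightarrow> real" where
  "multi_partial \<alpha> f = (partial 1 ^^ fst \<alpha>) ((partial 2 ^^ snd \<alpha>) f)"

definition locally_integrable :: "(real^2) set \<Rightarrow> (real^2 \<Rightarrow> real) \<Rightarrow> bool" where
  "locally_integrable \<Omega> f \<longleftrightarrow> (\<forall>K. compact K \<and> K \<subseteq> \<Omega> \<longrightarrow> f absolutely_integrable_on K)"

definition is_weak_deriv ::
    "(real^2) set \<Rightarrow> multi_index \<Rightarrow> (real^2 \<Rightarrow> real) \<Rightarrow> (real^2 \<Rightarrow> real) \<Rightarrow> bool" where
  "is_weak_deriv \<Omega> \<alpha> f g \<longleftrightarrow>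
     locally_integrable \<Omega> f \<and> locally_integrable \<Omega> g \<and>
     (\<forall>\<phi>\<in>test_functions \<Omega>.
        (LINT x|lebesgue_on \<Omega>. f x * multi_partial \<alpha> \<phi> x) =
        (-1) ^ ord_mi \<alpha> * (LINT x|lebesgue_on \<Omega>. g x * \<phi> x))"

(* Elements of L^2 and of the Sobolev spaces are represented by functions rather than by
   equivalence classes.  A weak derivative is unique up to a null set, so the choice made here
   does not affect any of the integrals below. *)
definition weak_deriv ::
    "(real^2) set \<Rightarrow> multi_index \<Rightarrow> (real^2 \<Rightarrow> real) \<Rightarrow> real^2 \<Rightarrow> real" where
  "weak_deriv \<Omega> \<alpha> f = (SOME g. is_weak_deriv \<Omega> \<alpha> f g)"

definition weak_partial :: "(real^2) set \<Rightarrow> 2 \<Rightarrow> (real^2 \<Rightarrow> real) \<Rightarrow> real^2 \<Rightarrow> real" where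
  "weak_partial \<Omega> i f = weak_deriv \<Omega> (if i = 1 then (1, 0) else (0, 1)) f"

definition L2_space :: "(real^2) set \<Rightarrow> (real^2 \<Rightarrow> real) set" where
  "L2_space \<Omega> =
     {f \<in> borel_measurable (lebesgue_on \<Omega>). integrable (lebesgue_on \<Omega>) (\<lambda>x. (f x)\<^sup>2)}"

definition sobolev :: "nat \<Rightarrow> (real^2) set \<Rightarrow> (real^2 \<Rightarrow> real) set" where
  "sobolev m \<Omega> =
     {f \<in> L2_space \<Omega>. \<forall>\<alpha>. ord_mi \<alpha> \<le> m \<longrightarrow> (\<exists>g\<in>L2_space \<Omega>. is_weak_deriv \<Omega> \<alpha> f g)}"

definition sobolev_seminorm :: "nat \<Rightarrow> (real^2) set \<Rightarrow> (real^2 \<Rightarrow> real) \<Rightarrow> real" where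
  "sobolev_seminorm k \<Omega> f =
     sqrt (LINT x|lebesgue_on \<Omega>. (\<Sum>\<alpha> | ord_mi \<alpha> = k. \<bar>weak_deriv \<Omega> \<alpha> f x\<bar>\<^sup>2))"

definition sobolev_norm :: "nat \<Rightarrow> (real^2) set \<Rightarrow> (real^2 \<Rightarrow> real) \<Rightarrow> real" where
  "sobolev_norm m \<Omega> f = sqrt (\<Sum>k\<le>m. (sobolev_seminorm k \<Omega> f)\<^sup>2)"

definition sobolev0 :: "nat \<Rightarrow> (real^2) set \<Rightarrow> (real^2 \<Rightarrow> real) set" where
  "sobolev0 m \<Omega> =
     {f \<in> sobolev m \<Omega>. \<forall>e>0. \<exists>\<phi>\<in>test_functions \<Omega>. sobolev_norm m \<Omega> (\<lambda>x. f x - \<phi> x) < e}"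

abbreviation component :: "(real^2 \<Rightarrow> real^2) \<Rightarrow> 2 \<Rightarrow> real^2 \<Rightarrow> real" where
  "component v i \<equiv> \<lambda>x. v x $ i"

definition sobolev0_vec :: "nat \<Rightarrow> (real^2) set \<Rightarrow> (real^2 \<Rightarrow> real^2) set" where
  "sobolev0_vec m \<Omega> = {v. \<forall>i. component v i \<in> sobolev0 m \<Omega>}"

definition sobolev_seminorm_vec :: "nat \<Rightarrow> (real^2) set \<Rightarrow> (real^2 \<Rightarrow> real^2) \<Rightarrow> real" where
  "sobolev_seminorm_vec k \<Omega> v = sqrt (\<Sum>i\<in>UNIV. (sobolev_seminorm k \<Omega> (component v i))\<^sup>2)"

definition sobolev_norm_vec :: "nat \<Rightarrow> (real^2) set \<Rightarrow> (real^2 \<Rightarrow> real^2) \<Rightarrow> real" where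
  "sobolev_norm_vec m \<Omega> v = sqrt (\<Sum>i\<in>UNIV. (sobolev_norm m \<Omega> (component v i))\<^sup>2)"

definition grad :: "(real^2) set \<Rightarrow> (real^2 \<Rightarrow> real^2) \<Rightarrow> 2 \<Rightarrow> 2 \<Rightarrow> real^2 \<Rightarrow> real" where
  "grad \<Omega> v i j = weak_partial \<Omega> j (component v i)"

definition poincare_const :: "(real^2) set \<Rightarrow> real \<Rightarrow> bool" where
  "poincare_const \<Omega> Cp \<longleftrightarrow>
     (\<forall>v\<in>sobolev0_vec 1 \<Omega>.
        sqrt (LINT x|lebesgue_on \<Omega>. (norm (v x))\<^sup>2)
        \<le> Cp * sqrt (LINT x|lebesgue_on \<Omega>. (\<Sum>i\<in>UNIV. \<Sum>j\<in>UNIV. (grad \<Omega> v i j x)\<^sup>2)))"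

definition strain :: "(real^2) set \<Rightarrow> (real^2 \<Rightarrow> real^2) \<Rightarrow> 2 \<Rightarrow> 2 \<Rightarrow> real^2 \<Rightarrow> real" where
  "strain \<Omega> v i j = (\<lambda>x. (grad \<Omega> v i j x + grad \<Omega> v j i x) / 2)"

definition strain_grad ::
    "(real^2) set \<Rightarrow> (real^2 \<Rightarrow> real^2) \<Rightarrow> 2 \<Rightarrow> 2 \<Rightarrow> 2 \<Rightarrow> real^2 \<Rightarrow> real" where
  "strain_grad \<Omega> v i j k = weak_partial \<Omega> i (strain \<Omega> v j k)"

definition kronecker :: "2 \<Rightarrow> 2 \<Rightarrow> real" where
  "kronecker i j = (if i = j then 1 else 0)"

definition C_tensor :: "real \<Rightarrow> real \<Rightarrow> 2 \<Rightarrow> 2 \<Rightarrow> 2 \<Rightarrow> 2 \<Rightarrow> real" where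
  "C_tensor lam \<mu> i j k l =
     lam * kronecker i j * kronecker k l + 2 * \<mu> * kronecker i k * kronecker j l"

definition D_tensor ::
    "real \<Rightarrow> real \<Rightarrow> real \<Rightarrow> 2 \<Rightarrow> 2 \<Rightarrow> 2 \<Rightarrow> 2 \<Rightarrow> 2 \<Rightarrow> 2 \<Rightarrow> real" where
  "D_tensor lam \<mu> \<iota> i j k l m n =
     \<iota>\<^sup>2 * (lam * kronecker i l * kronecker j k * kronecker m n
           + 2 * \<mu> * kronecker i l * kronecker j m * kronecker k n)"

definition a_form ::
    "real \<Rightarrow> real \<Rightarrow> real \<Rightarrow> (real^2) set \<Rightarrow> (real^2 \<Rightarrow> real^2) \<Rightarrow> (real^2 \<Rightarrow> real^2) \<Rightarrow> real" where
  "a_form lam \<mu> \<iota> \<Omega> u v =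
     (LINT x|lebesgue_on \<Omega>. (\<Sum>i\<in>UNIV. \<Sum>j\<in>UNIV.
        (\<Sum>k\<in>UNIV. \<Sum>l\<in>UNIV. C_tensor lam \<mu> i j k l * strain \<Omega> u k l x) * strain \<Omega> v i j x))
   + (LINT x|lebesgue_on \<Omega>. (\<Sum>i\<in>UNIV. \<Sum>j\<in>UNIV. \<Sum>k\<in>UNIV.
        (\<Sum>l\<in>UNIV. \<Sum>m\<in>UNIV. \<Sum>n\<in>UNIV.
           D_tensor lam \<mu> \<iota> i j k l m n * strain_grad \<Omega> u l m n x) * strain_grad \<Omega> v i j k x))"

end

theory Submission
  imports Defs
begin

text \<open>Write \<open>p\<close> for a matrix field with entries in \<open>L\<^sup>2\<close>, \<open>e\<close> for its symmetric part and
  \<open>N = p\<^sub>1\<^sub>2 p\<^sub>2\<^sub>1 - p\<^sub>1\<^sub>1 p\<^sub>2\<^sub>2\<close> for minus its determinant.  Pointwise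

  \<open>2\<mu> |e|\<^sup>2 + \<lambda> (tr e)\<^sup>2 = \<mu> |p|\<^sup>2 + (\<mu> + \<lambda>) (tr p)\<^sup>2 + 2\<mu> N\<close> and
  \<open>(tr p)\<^sup>2 + (p\<^sub>1\<^sub>2 - p\<^sub>2\<^sub>1)\<^sup>2 = |p|\<^sup>2 - 2 N\<close>,

  so as soon as \<open>\<integral>N = 0\<close> the energy of \<open>e\<close> lies between \<open>\<mu> \<parallel>p\<parallel>\<^sup>2\<close> and \<open>(2\<mu> + \<lambda>) \<parallel>p\<parallel>\<^sup>2\<close>
  (\<open>energy_sym_bounds\<close>).  For a field \<open>v\<close> that vanishes on the boundary the determinant of a Jacobian
  is a null Lagrangian, which makes the bounds applicable to \<open>p = \<nabla>v\<close> and, if \<open>v\<close> is in \<open>H\<^sub>0\<^sup>2\<close>, to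
  \<open>p = \<nabla>\<partial>\<^sub>1v\<close> and \<open>p = \<nabla>\<partial>\<^sub>2v\<close>.  These three energies make up \<open>a(v,v)\<close>.

  For the lower bound it remains to absorb \<open>\<parallel>v\<parallel>\<^sup>2\<close> by the Poincare inequality, which gives the constant
  \<open>\<mu> / (1 + C\<^sub>p\<^sup>2)\<close>.  For the upper bound the multi-index seminorm matters: it counts the mixed
  derivative once, whereas \<open>F = \<parallel>\<nabla>\<nabla>v\<parallel>\<^sup>2\<close> counts it twice.  Another null Lagrangian gives
  \<open>\<parallel>\<partial>\<^sub>1\<partial>\<^sub>2f\<parallel>\<^sup>2 = \<integral> \<partial>\<^sub>1\<partial>\<^sub>1f \<partial>\<^sub>2\<partial>\<^sub>2f \<le> (\<parallel>\<partial>\<^sub>1\<partial>\<^sub>1f\<parallel>\<^sup>2 + \<parallel>\<partial>\<^sub>2\<partial>\<^sub>2f\<parallel>\<^sup>2) / 2\<close>, hence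
  \<open>F \<le> 4/3 |v|\<^sub>H\<^sub>2\<^sup>2\<close> (\<open>sobolev0_second_derivatives\<close>), and \<open>4/3 (2\<mu> + \<lambda>) \<le> 2 (\<lambda> + \<mu>)\<close> is exactly the
  condition \<open>\<mu> \<le> \<lambda>\<close>.

  All null Lagrangians are instances of one identity, \<open>sobolev0_exchange_derivatives\<close>: the \<open>L\<^sup>2\<close> product
  of two derivatives of order \<open>m\<close>, one of a function in \<open>H\<^sub>0\<^sup>m\<close> and one of a function in \<open>H\<^sup>m\<close>, depends
  only on the sum of the two multi-indices.  For test functions this is the definition of a weak
  derivative; the rest is density.  Density can be used because weak derivatives, which are given by a
  choice operator, are determined almost everywhere: this is the fundamental lemma of the calculus of
  variations (\<open>fundamental_lemma\<close>).  The Poincare constant of a bounded domain comes from integrating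
  \<open>\<partial>\<^sub>1(x\<^sub>1\<phi>\<^sup>2)\<close> (\<open>test_Poincare\<close>).\<close>

section \<open>Calculus of smooth functions on the plane\<close>

definition smooth :: "(real^2 \<Rightarrow> real) \<Rightarrow> bool" where
  "smooth f \<longleftrightarrow> (\<forall>k. C_k k f)"

lemma partial_of_has_derivative:
  assumes "(f has_derivative f') (at x)"
  shows "partial i f x = f' (axis i 1)"
  using frechet_derivative_at[OF assms] by (simp add: partial_def)

lemma C_k_has_derivative:
  assumes "C_k (Suc k) f"
  shows "(f has_derivative frechet_derivative f (at x)) (at x)"
  using assms by (simp add: differentiable_on_def frechet_derivative_works)

lemma C_k_SucD: "C_k (Suc k) f \<Longrightarrow> C_k k f"
  by (induction k arbitrary: f) (auto intro: differentiable_imp_continuous_on)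

lemma C_k_continuous: "C_k k f \<Longrightarrow> continuous_on UNIV f"
  by (cases k) (auto intro: differentiable_imp_continuous_on)

lemma partial_const: "partial i (\<lambda>x. c) = (\<lambda>x. 0)"
  by (rule ext, subst partial_of_has_derivative[OF has_derivative_const]) simp

lemma C_k_add:
  assumes "C_k k f" "C_k k g"
  shows "C_k k (\<lambda>x. f x + g x)"
  using assms
proof (induction k arbitrary: f g)
  case 0
  then show ?case by (auto intro: continuous_intros)
next
  case (Suc k)
  have "partial i (\<lambda>x. f x + g x) = (\<lambda>x. partial i f x + partial i g x)" for i
    by (rule ext, subst partial_of_has_derivative[OF has_derivative_add[OF
          C_k_has_derivative[OF Suc.prems(1)] C_k_has_derivative[OF Suc.prems(2)]]])
       (simp add: partial_def)
  with Suc show ?case by (auto simp: differentiable_on_def)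
qed

lemma partial_mult:
  assumes "C_k (Suc k) f" "C_k (Suc k) g"
  shows "partial i (\<lambda>x. f x * g x) = (\<lambda>x. f x * partial i g x + partial i f x * g x)"
  by (rule ext, subst partial_of_has_derivative[OF has_derivative_mult[OF
        C_k_has_derivative[OF assms(1)] C_k_has_derivative[OF assms(2)]]])
     (simp add: partial_def)

lemma C_k_mult:
  assumes "C_k k f" "C_k k g"
  shows "C_k k (\<lambda>x. f x * g x)"
  using assms
proof (induction k arbitrary: f g)
  case 0
  then show ?case by (auto intro: continuous_intros)
next
  case (Suc k)
  have "C_k k (partial i (\<lambda>x. f x * g x))" for i
    unfolding partial_mult[OF Suc.prems]
    using Suc.prems C_k_SucD[OF Suc.prems(1)] C_k_SucD[OF Suc.prems(2)]
    by (intro C_k_add Suc.IH) auto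
  with Suc.prems show ?case by (auto simp: differentiable_on_def)
qed

lemma smooth_continuous: "smooth f \<Longrightarrow> continuous_on UNIV f"
  using C_k_continuous smooth_def by blast

lemma smooth_has_derivative: "smooth f \<Longrightarrow> (f has_derivative frechet_derivative f (at x)) (at x)"
  using C_k_has_derivative smooth_def by blast

lemma smooth_mult: "smooth f \<Longrightarrow> smooth g \<Longrightarrow> smooth (\<lambda>x. f x * g x)"
  by (simp add: smooth_def C_k_mult)

lemma smooth_partial_mult:
  "smooth f \<Longrightarrow> smooth g \<Longrightarrow>
    partial i (\<lambda>x. f x * g x) = (\<lambda>x. f x * partial i g x + partial i f x * g x)"
  using partial_mult smooth_def by blast

lemma smooth_partial: "smooth f \<Longrightarrow> smooth (partial i f)"
  unfolding smooth_def using C_k.simps(2) by blast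

lemma smooth_partial_funpow: "smooth f \<Longrightarrow> smooth ((partial i ^^ n) f)"
  by (induction n) (auto intro: smooth_partial)

lemma smooth_multi_partial: "smooth f \<Longrightarrow> smooth (multi_partial \<alpha> f)"
  by (simp add: multi_partial_def smooth_partial_funpow)

text \<open>The coinductive way to recognise smooth functions: a family of differentiable functions
  that is closed under partial differentiation consists of smooth functions.\<close>

lemma smooth_family:
  assumes "f \<in> F"
    and diff: "\<And>f. f \<in> F \<Longrightarrow> f differentiable_on UNIV"
    and closed: "\<And>f i. f \<in> F \<Longrightarrow> partial i f \<in> F"
  shows "smooth f"
proof -
  have "C_k k f" for k
    using \<open>f \<in> F\<close>
    by (induction k arbitrary: f) (auto intro: diff closed differentiable_imp_continuous_on)
  then show ?thesis by (simp add: smooth_def)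
qed

lemma has_derivative_coordinate: "((\<lambda>x::real^2. x $ j) has_derivative (\<lambda>x. x $ j)) (at x)"
  by (rule bounded_linear_imp_has_derivative[OF bounded_linear_vec_nth])

lemma partial_coordinate: "partial i (\<lambda>x. x $ j) = (\<lambda>x. if i = j then 1 else 0)"
  by (rule ext, subst partial_of_has_derivative[OF has_derivative_coordinate]) (auto simp: axis_def)

lemma smooth_coordinate: "smooth (\<lambda>x. x $ j)"
proof (rule smooth_family)
  let ?F = "insert (\<lambda>x::real^2. x $ j) (range (\<lambda>c x. c))"
  show "(\<lambda>x. x $ j) \<in> ?F" by simp
  show "f differentiable_on UNIV" if "f \<in> ?F" for f
    using that has_derivative_coordinate has_derivative_const
    by (fastforce simp: differentiable_on_def differentiable_def)
  show "partial i f \<in> ?F" if "f \<in> ?F" for f i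
    using that by (auto simp: partial_const partial_coordinate)
qed

lemma smooth_line_derivative:
  assumes "smooth f"
  shows "((\<lambda>t. f (x + t *\<^sub>R axis i 1)) has_real_derivative partial i f (x + t *\<^sub>R axis i 1)) (at t)"
proof -
  have "((\<lambda>t. f (x + t *\<^sub>R axis i 1)) has_derivative
      (\<lambda>s. frechet_derivative f (at (x + t *\<^sub>R axis i 1)) (s *\<^sub>R axis i 1))) (at t)"
    by (rule has_derivative_compose[OF _ smooth_has_derivative[OF assms]])
       (auto intro!: derivative_eq_intros)
  moreover have "frechet_derivative f (at y) (s *\<^sub>R axis i 1) = partial i f y * s" for s y
    using linear_cmul[OF has_derivative_linear[OF smooth_has_derivative[OF assms]]]
    by (simp add: partial_def)
  ultimately show ?thesis
    by (simp add: has_field_derivative_def)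
qed

text \<open>Symmetry of second derivatives.  The second difference over a square of side \<open>h\<close> does not
  depend on the order of the two directions, and the mean value theorem, applied in one direction
  and then in the other, turns it into \<open>h\<^sup>2\<close> times a mixed derivative near the corner.\<close>

lemma second_difference_mean_value:
  assumes f: "smooth f" and h: "0 < h"
  obtains s t where "0 < s" "s < h" "0 < t" "t < h"
    "f (x + h *\<^sub>R axis i 1 + h *\<^sub>R axis j 1) - f (x + h *\<^sub>R axis i 1) - f (x + h *\<^sub>R axis j 1) + f x
      = h\<^sup>2 * partial j (partial i f) (x + s *\<^sub>R axis i 1 + t *\<^sub>R axis j 1)"
proof -
  define F where "F t = f ((x + h *\<^sub>R axis j 1) + t *\<^sub>R axis i 1) - f (x + t *\<^sub>R axis i 1)" for t
  have dF: "(F has_real_derivative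
      partial i f ((x + h *\<^sub>R axis j 1) + t *\<^sub>R axis i 1) - partial i f (x + t *\<^sub>R axis i 1)) (at t)" for t
    unfolding F_def by (intro DERIV_diff smooth_line_derivative f)
  obtain s where s: "0 < s" "s < h" "F h - F 0 = (h - 0) *
      (partial i f ((x + h *\<^sub>R axis j 1) + s *\<^sub>R axis i 1) - partial i f (x + s *\<^sub>R axis i 1))"
    using MVT2[OF h dF] by blast
  obtain t where t: "0 < t" "t < h"
    "partial i f ((x + s *\<^sub>R axis i 1) + h *\<^sub>R axis j 1) - partial i f ((x + s *\<^sub>R axis i 1) + 0 *\<^sub>R axis j 1)
      = (h - 0) * partial j (partial i f) ((x + s *\<^sub>R axis i 1) + t *\<^sub>R axis j 1)"
    using MVT2[OF h smooth_line_derivative[OF smooth_partial[OF f]]] by blast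
  have *: "partial i f ((x + h *\<^sub>R axis j 1) + s *\<^sub>R axis i 1) - partial i f (x + s *\<^sub>R axis i 1)
      = h * partial j (partial i f) (x + s *\<^sub>R axis i 1 + t *\<^sub>R axis j 1)"
    using t(3) by (simp add: add_ac)
  show ?thesis
    by (rule that[OF s(1,2) t(1,2)])
       (use s(3) in \<open>unfold *, simp add: F_def power2_eq_square add_ac\<close>)
qed

lemma partial_commute:
  assumes f: "smooth f"
  shows "partial i (partial j f) = partial j (partial i f)"
proof
  fix x
  define e where "e n = inverse (real (Suc n))" for n
  have e0: "e \<longlonglongrightarrow> 0" unfolding e_def by (rule LIMSEQ_inverse_real_of_nat)
  have epos: "0 < e n" for n by (simp add: e_def)
  define \<Delta> where "\<Delta> a b n = f (x + e n *\<^sub>R axis a 1 + e n *\<^sub>R axis b 1)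
    - f (x + e n *\<^sub>R axis a 1) - f (x + e n *\<^sub>R axis b 1) + f x" for a b n
  have lim: "\<exists>y. y \<longlonglongrightarrow> x \<and> (\<forall>n. \<Delta> a b n = (e n)\<^sup>2 * partial b (partial a f) (y n))" for a b
  proof -
    have "\<forall>n. \<exists>s t. 0 < s \<and> s < e n \<and> 0 < t \<and> t < e n \<and>
      \<Delta> a b n = (e n)\<^sup>2 * partial b (partial a f) (x + s *\<^sub>R axis a 1 + t *\<^sub>R axis b 1)"
      unfolding \<Delta>_def using second_difference_mean_value[OF f epos] by metis
    then obtain s t where st: "\<And>n. 0 < s n \<and> s n < e n \<and> 0 < t n \<and> t n < e n \<and>
      \<Delta> a b n = (e n)\<^sup>2 * partial b (partial a f) (x + s n *\<^sub>R axis a 1 + t n *\<^sub>R axis b 1)"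
      by metis
    have "s \<longlonglongrightarrow> 0" "t \<longlonglongrightarrow> 0"
      by (rule tendsto_sandwich[OF _ _ tendsto_const e0];
          use st in \<open>auto intro!: always_eventually less_imp_le\<close>)+
    then have "(\<lambda>n. x + s n *\<^sub>R axis a 1 + t n *\<^sub>R axis b 1) \<longlonglongrightarrow> x + 0 *\<^sub>R axis a 1 + 0 *\<^sub>R axis b 1"
      by (intro tendsto_intros)
    with st show ?thesis
      by (intro exI[of _ "\<lambda>n. x + s n *\<^sub>R axis a 1 + t n *\<^sub>R axis b 1"]) simp
  qed
  obtain y where y: "y \<longlonglongrightarrow> x" "\<And>n. \<Delta> i j n = (e n)\<^sup>2 * partial j (partial i f) (y n)"
    using lim by blast
  obtain z where z: "z \<longlonglongrightarrow> x" "\<And>n. \<Delta> j i n = (e n)\<^sup>2 * partial i (partial j f) (z n)"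
    using lim by blast
  have "\<Delta> i j n = \<Delta> j i n" for n by (simp add: \<Delta>_def add_ac)
  then have eq: "partial j (partial i f) (y n) = partial i (partial j f) (z n)" for n
    using y(2)[of n] z(2)[of n] epos[of n] by simp
  have cont: "isCont (partial a (partial b f)) x" for a b
    using smooth_continuous[OF smooth_partial[OF smooth_partial[OF f]]]
    by (simp add: continuous_on_eq_continuous_at)
  have "(\<lambda>n. partial j (partial i f) (y n)) \<longlonglongrightarrow> partial j (partial i f) x"
    "(\<lambda>n. partial i (partial j f) (z n)) \<longlonglongrightarrow> partial i (partial j f) x"
    using isCont_tendsto_compose[OF cont] y(1) z(1) by blast+
  then show "partial i (partial j f) x = partial j (partial i f) x"
    unfolding eq using LIMSEQ_unique by blast
qed

text \<open>With symmetry available, the order of differentiation that is built into the definition of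
  \<open>multi_partial\<close> becomes irrelevant, and multi-indices simply add.\<close>

lemma multi_partial_multi_partial:
  assumes f: "smooth f"
  shows "multi_partial \<alpha> (multi_partial \<beta> f) = multi_partial (\<alpha> + \<beta>) f"
proof -
  have c1: "partial i ((partial j ^^ n) g) = (partial j ^^ n) (partial i g)" if "smooth g" for i j n g
    using that by (induction n) (auto simp: partial_commute[of _ i j] smooth_partial_funpow)
  have c2: "(partial 2 ^^ n) ((partial 1 ^^ m) g) = (partial 1 ^^ m) ((partial 2 ^^ n) g)"
    if "smooth g" for m n g
    using that by (induction n) (auto simp: c1 smooth_partial_funpow)
  show ?thesis
    using c2[OF smooth_partial_funpow[OF f]]
    by (simp add: multi_partial_def funpow_add)
qed

section \<open>Test functions and integration by parts\<close>

text \<open>Membership in \<open>test_functions\<close> is easier to establish and to use through some compact set outside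
  of which the function vanishes than through the closure of the set of its nonzeros.\<close>

lemma test_functionsI:
  assumes "smooth \<phi>" "compact K" "K \<subseteq> \<Omega>" "\<And>x. x \<notin> K \<Longrightarrow> \<phi> x = 0"
  shows "\<phi> \<in> test_functions \<Omega>"
proof -
  have sub: "closure {x. \<phi> x \<noteq> 0} \<subseteq> K"
    by (rule closure_minimal) (use assms in \<open>auto intro: compact_imp_closed\<close>)
  moreover have "compact (closure {x. \<phi> x \<noteq> 0})"
    using compact_Int_closed[OF assms(2) closed_closure, of "{x. \<phi> x \<noteq> 0}"] sub
    by (simp add: Int_absorb1)
  ultimately show ?thesis
    using assms by (auto simp: test_functions_def smooth_def)
qed

lemma test_functionsE:
  assumes "\<phi> \<in> test_functions \<Omega>"
  obtains K where "smooth \<phi>" "compact K" "K \<subseteq> \<Omega>" "\<forall>x. x \<notin> K \<longrightarrow> \<phi> x = 0"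
proof (rule that[of "closure {x. \<phi> x \<noteq> 0}"])
  show "\<forall>x. x \<notin> closure {x. \<phi> x \<noteq> 0} \<longrightarrow> \<phi> x = 0"
    using closure_subset[of "{x. \<phi> x \<noteq> 0}"] by auto
qed (use assms in \<open>auto simp: test_functions_def smooth_def\<close>)

lemma test_smooth: "\<phi> \<in> test_functions \<Omega> \<Longrightarrow> smooth \<phi>"
  by (simp add: test_functions_def smooth_def)

lemma partial_outside:
  assumes "closed K" "\<And>x. x \<notin> K \<Longrightarrow> f x = 0" "x \<notin> K"
  shows "partial i f x = 0"
proof -
  have "(f has_derivative (\<lambda>_. 0)) (at x)"
    by (rule has_derivative_transform_within_open[of "\<lambda>_. 0" _ _ _ "- K"])
       (use assms in auto)
  then show ?thesis by (simp add: partial_of_has_derivative)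
qed

lemma test_partial: "\<phi> \<in> test_functions \<Omega> \<Longrightarrow> partial i \<phi> \<in> test_functions \<Omega>"
  by (erule test_functionsE, rule test_functionsI)
     (auto intro: smooth_partial partial_outside compact_imp_closed)

lemma test_multi_partial: "\<phi> \<in> test_functions \<Omega> \<Longrightarrow> multi_partial \<alpha> \<phi> \<in> test_functions \<Omega>"
proof -
  have "(partial i ^^ n) \<phi> \<in> test_functions \<Omega>" if "\<phi> \<in> test_functions \<Omega>" for i n \<phi>
    using that by (induction n) (auto intro: test_partial)
  then show "\<phi> \<in> test_functions \<Omega> \<Longrightarrow> ?thesis" by (simp add: multi_partial_def)
qed

lemma test_smooth_mult: "smooth f \<Longrightarrow> \<phi> \<in> test_functions \<Omega> \<Longrightarrow> (\<lambda>x. f x * \<phi> x) \<in> test_functions \<Omega>"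
  by (erule test_functionsE, rule test_functionsI) (auto intro: smooth_mult)

lemma continuous_compact_support_bounded:
  fixes \<phi> :: "real^2 \<Rightarrow> real"
  assumes "continuous_on UNIV \<phi>" "compact K" "\<And>x. x \<notin> K \<Longrightarrow> \<phi> x = 0"
  obtains B where "0 \<le> B" "\<forall>x. \<bar>\<phi> x\<bar> \<le> B"
proof -
  have "bounded (\<phi> ` K)"
    using assms(1,2) compact_continuous_image continuous_on_subset compact_imp_bounded by blast
  then obtain B where "\<forall>x\<in>K. \<bar>\<phi> x\<bar> \<le> B"
    by (auto simp: bounded_iff)
  then have "\<bar>\<phi> x\<bar> \<le> max B 0" for x
    using assms(3)[of x] by (cases "x \<in> K") (auto simp: max_def)
  then show thesis by (intro that[of "max B 0"]) auto
qed

lemma test_integrable_lborel: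
  assumes "\<phi> \<in> test_functions \<Omega>"
  shows "integrable lborel \<phi>"
proof -
  obtain K where K: "smooth \<phi>" "compact K" "K \<subseteq> \<Omega>" "\<forall>x. x \<notin> K \<longrightarrow> \<phi> x = 0"
    by (rule test_functionsE[OF assms])
  have "integrable lborel (\<lambda>x. indicator K x *\<^sub>R \<phi> x)"
    by (rule borel_integrable_compact[OF K(2)], rule continuous_on_subset[OF smooth_continuous[OF K(1)]]) simp
  also have "(\<lambda>x. indicator K x *\<^sub>R \<phi> x) = \<phi>"
    by (rule ext) (use K(4) in \<open>auto simp: indicator_def\<close>)
  finally show ?thesis .
qed

lemma test_integral_lebesgue_on:
  assumes "open \<Omega>" and \<phi>: "\<phi> \<in> test_functions \<Omega>"
  shows "(LINT x|lebesgue_on \<Omega>. \<phi> x) = (LINT x|lborel. \<phi> x)"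
proof -
  obtain K where K: "smooth \<phi>" "compact K" "K \<subseteq> \<Omega>" "\<forall>x. x \<notin> K \<longrightarrow> \<phi> x = 0"
    by (rule test_functionsE[OF \<phi>])
  have "(LINT x|lebesgue_on \<Omega>. \<phi> x) = (LINT x|lebesgue. (if x \<in> \<Omega> then \<phi> x else 0))"
    by (rule Lebesgue_Measure.integral_restrict_UNIV[symmetric]) (use assms in auto)
  also have "(\<lambda>x. if x \<in> \<Omega> then \<phi> x else 0) = \<phi>"
    by (rule ext) (use K in auto)
  also have "(LINT x|lebesgue. \<phi> x) = (LINT x|lborel. \<phi> x)"
    by (rule integral_completion) (use test_integrable_lborel[OF \<phi>] in auto)
  finally show ?thesis .
qed

text \<open>The integral of the difference quotient \<open>n (\<phi> (x + e\<^sub>i / n) - \<phi> x)\<close> vanishes because Lebesgue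
  measure is translation invariant; the quotients converge to \<open>\<partial>\<^sub>i \<phi>\<close> and are dominated by a constant
  on a fixed ball.\<close>

lemma integral_partial_test_eq_0:
  assumes "\<phi> \<in> test_functions \<Omega>"
  shows "(LINT x|lborel. partial i \<phi> x) = 0"
proof -
  obtain K where K: "smooth \<phi>" "compact K" "K \<subseteq> \<Omega>" "\<forall>x. x \<notin> K \<longrightarrow> \<phi> x = 0"
    by (rule test_functionsE[OF assms])
  define e where "e n = inverse (real (Suc n))" for n
  have epos: "0 < e n" and ele: "e n \<le> 1" for n by (auto simp: e_def field_simps)
  have e0: "e \<longlonglongrightarrow> 0" unfolding e_def by (rule LIMSEQ_inverse_real_of_nat)
  define q where "q n x = (\<phi> (x + e n *\<^sub>R axis i 1) - \<phi> x) / e n" for n x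
  obtain B where B: "0 \<le> B" "\<forall>x. \<bar>partial i \<phi> x\<bar> \<le> B"
    by (rule continuous_compact_support_bounded[OF smooth_continuous[OF smooth_partial[OF K(1), of i]]
          K(2) partial_outside[OF compact_imp_closed[OF K(2)] K(4)[rule_format]]])
  obtain R where R: "\<And>x. x \<in> K \<Longrightarrow> norm x \<le> R"
    using compact_imp_bounded[OF K(2)] by (auto simp: bounded_iff)
  have int: "integrable lborel \<phi>" by (rule test_integrable_lborel[OF assms])
  have shift: "integrable lborel (\<lambda>x. \<phi> (x + c)) \<and> (LINT x|lborel. \<phi> (x + c)) = (LINT x|lborel. \<phi> x)" for c
  proof -
    have m: "\<phi> \<in> borel_measurable borel" using int by auto
    have "integrable (distr lborel borel ((+) c)) \<phi>"
      using int by (simp add: lborel_distr_plus)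
    then have "integrable lborel (\<lambda>x. \<phi> (c + x))"
      by (subst (asm) integrable_distr_eq) (use m in auto)
    moreover have "(LINT x|distr lborel borel ((+) c). \<phi> x) = (LINT x|lborel. \<phi> (c + x))"
      by (rule integral_distr) (use m in auto)
    ultimately show ?thesis by (simp add: lborel_distr_plus add.commute)
  qed
  have q0: "(LINT x|lborel. q n x) = 0" for n
    unfolding q_def using shift[of "e n *\<^sub>R axis i 1"] int by simp
  have lim: "(\<lambda>n. q n x) \<longlonglongrightarrow> partial i \<phi> x" for x
  proof -
    have "((\<lambda>t. \<phi> (x + t *\<^sub>R axis i 1)) has_real_derivative partial i \<phi> x) (at 0)"
      using smooth_line_derivative[OF K(1), of x i 0] by simp
    then have "((\<lambda>h. (\<phi> (x + h *\<^sub>R axis i 1) - \<phi> x) / h) \<longlongrightarrow> partial i \<phi> x) (at 0)"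
      by (simp add: DERIV_def)
    moreover have "filterlim e (at 0) sequentially"
      using e0 epos by (auto simp: filterlim_at less_imp_neq[symmetric])
    ultimately show ?thesis
      unfolding q_def by (rule filterlim_compose)
  qed
  \<comment> \<open>The radius is enlarged by \<open>1\<close> because the quotient also sees the shifted argument.\<close>
  have bound: "norm (q n x) \<le> indicator (cball 0 (R + 1)) x *\<^sub>R B" for n x
  proof (cases "x \<in> cball 0 (R + 1)")
    case True
    obtain t where "\<phi> (x + e n *\<^sub>R axis i 1) - \<phi> (x + 0 *\<^sub>R axis i 1) = (e n - 0) * partial i \<phi> (x + t *\<^sub>R axis i 1)"
      using MVT2[OF epos smooth_line_derivative[OF K(1)]] by blast
    then have "q n x = partial i \<phi> (x + t *\<^sub>R axis i 1)"
      using epos[of n] by (simp add: q_def field_simps)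
    with B(2) True show ?thesis by simp
  next
    case False
    have "norm x \<le> norm (x + e n *\<^sub>R axis i 1) + norm (e n *\<^sub>R axis i 1 :: real^2)"
      by (metis add_diff_cancel norm_triangle_ineq4)
    then have "norm x \<le> norm (x + e n *\<^sub>R axis i 1) + 1"
      using ele[of n] epos[of n] by simp
    with False have "x \<notin> K" "x + e n *\<^sub>R axis i 1 \<notin> K"
      using R[of x] R[of "x + e n *\<^sub>R axis i 1"] by auto
    then show ?thesis using B(1) by (simp add: q_def K(4))
  qed
  have "(\<lambda>n. LINT x|lborel. q n x) \<longlonglongrightarrow> (LINT x|lborel. partial i \<phi> x)"
  proof (rule integral_dominated_convergence[where w = "\<lambda>x. indicator (cball 0 (R + 1)) x *\<^sub>R B"])
    show "partial i \<phi> \<in> borel_measurable lborel"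
      using test_integrable_lborel[OF test_partial[OF assms]] by auto
    show "q n \<in> borel_measurable lborel" for n
      unfolding q_def using shift[of "e n *\<^sub>R axis i 1"] int by auto
    show "integrable lborel (\<lambda>x. indicator (cball 0 (R + 1)) x *\<^sub>R B)"
      by (rule borel_integrable_compact) auto
  qed (use lim bound in auto)
  then have "(\<lambda>n. 0) \<longlonglongrightarrow> (LINT x|lborel. partial i \<phi> x)" by (simp only: q0)
  then show ?thesis using LIMSEQ_unique[OF tendsto_const] by metis
qed

lemma test_integrable_on:
  assumes "open \<Omega>" "\<phi> \<in> test_functions \<Omega>"
  shows "integrable (lebesgue_on \<Omega>) \<phi>"
proof -
  obtain K where K: "smooth \<phi>" "compact K" "K \<subseteq> \<Omega>" "\<forall>x. x \<notin> K \<longrightarrow> \<phi> x = 0"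
    by (rule test_functionsE[OF assms(2)])
  have "(\<lambda>x. if x \<in> \<Omega> then \<phi> x else 0) = \<phi>"
    by (rule ext) (use K in auto)
  moreover have "integrable lebesgue \<phi>"
    using test_integrable_lborel[OF assms(2)] by (subst integrable_completion) auto
  ultimately show ?thesis
    using Lebesgue_Measure.integrable_restrict_UNIV[of \<Omega> \<phi>] \<open>open \<Omega>\<close> by simp
qed

lemma integration_by_parts:
  assumes "open \<Omega>" "smooth f" and \<phi>: "\<phi> \<in> test_functions \<Omega>"
  shows "(LINT x|lebesgue_on \<Omega>. f x * partial i \<phi> x) = - (LINT x|lebesgue_on \<Omega>. partial i f x * \<phi> x)"
proof -
  have f\<phi>: "(\<lambda>x. f x * \<phi> x) \<in> test_functions \<Omega>" by (rule test_smooth_mult[OF assms(2,3)])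
  have "0 = (LINT x|lebesgue_on \<Omega>. partial i (\<lambda>x. f x * \<phi> x) x)"
    using integral_partial_test_eq_0[OF f\<phi>] test_integral_lebesgue_on[OF assms(1) test_partial[OF f\<phi>]]
    by simp
  also have "\<dots> = (LINT x|lebesgue_on \<Omega>. f x * partial i \<phi> x + partial i f x * \<phi> x)"
    by (simp add: smooth_partial_mult[OF assms(2) test_smooth[OF \<phi>]])
  also have "\<dots> = (LINT x|lebesgue_on \<Omega>. f x * partial i \<phi> x) + (LINT x|lebesgue_on \<Omega>. partial i f x * \<phi> x)"
    by (rule Bochner_Integration.integral_add)
       (intro test_integrable_on assms test_smooth_mult test_partial smooth_partial)+
  finally show ?thesis by simp
qed

lemma integration_by_parts_multi:
  assumes "open \<Omega>" "smooth f" and \<phi>: "\<phi> \<in> test_functions \<Omega>"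
  shows "(LINT x|lebesgue_on \<Omega>. f x * multi_partial \<alpha> \<phi> x)
    = (-1) ^ ord_mi \<alpha> * (LINT x|lebesgue_on \<Omega>. multi_partial \<alpha> f x * \<phi> x)"
proof -
  have pow: "(LINT x|lebesgue_on \<Omega>. f x * (partial i ^^ n) \<phi> x)
    = (-1) ^ n * (LINT x|lebesgue_on \<Omega>. (partial i ^^ n) f x * \<phi> x)"
    if "smooth f" "\<phi> \<in> test_functions \<Omega>" for i n f \<phi>
    using that
  proof (induction n arbitrary: \<phi>)
    case (Suc n)
    have "(LINT x|lebesgue_on \<Omega>. f x * (partial i ^^ Suc n) \<phi> x)
      = (LINT x|lebesgue_on \<Omega>. f x * (partial i ^^ n) (partial i \<phi>) x)"
      by (simp only: funpow_Suc_right o_def)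
    also have "\<dots> = (-1) ^ n * (LINT x|lebesgue_on \<Omega>. (partial i ^^ n) f x * partial i \<phi> x)"
      using Suc by (intro Suc.IH test_partial)
    also have "\<dots> = (-1) ^ Suc n * (LINT x|lebesgue_on \<Omega>. (partial i ^^ Suc n) f x * \<phi> x)"
      using integration_by_parts[OF assms(1) smooth_partial_funpow[OF Suc.prems(1)] Suc.prems(2)] by simp
    finally show ?case .
  qed simp
  have t2: "(partial 2 ^^ n) \<phi> \<in> test_functions \<Omega>" for n
    using test_multi_partial[OF \<phi>, of "(0, n)"] by (simp add: multi_partial_def)
  have comm: "(partial 2 ^^ snd \<alpha>) ((partial 1 ^^ fst \<alpha>) f) = multi_partial \<alpha> f"
    using multi_partial_multi_partial[OF assms(2), of "(0, snd \<alpha>)" "(fst \<alpha>, 0)"]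
    by (simp add: multi_partial_def)
  show ?thesis
    unfolding multi_partial_def[of \<alpha> \<phi>] pow[OF assms(2) t2]
      pow[OF smooth_partial_funpow[OF assms(2)] \<phi>] comm
    by (simp add: ord_mi_def power_add)
qed

lemma continuous_locally_integrable:
  assumes "continuous_on UNIV f"
  shows "locally_integrable \<Omega> f"
  unfolding locally_integrable_def set_integrable_def
proof safe
  fix K :: "(real^2) set" assume K: "compact K"
  have "integrable lborel (\<lambda>x. indicator K x *\<^sub>R f x)"
    by (rule borel_integrable_compact[OF K]) (use assms continuous_on_subset in blast)
  then show "integrable lebesgue (\<lambda>x. indicator K x *\<^sub>R f x)"
    by (subst integrable_completion) auto
qed

text \<open>Only the test function has to have compact support, so classical derivatives are weak derivatives
  for every smooth function on the plane.\<close>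

lemma smooth_is_weak_deriv:
  assumes "open \<Omega>" "smooth f"
  shows "is_weak_deriv \<Omega> \<alpha> f (multi_partial \<alpha> f)"
  unfolding is_weak_deriv_def
  using assms integration_by_parts_multi continuous_locally_integrable smooth_continuous smooth_multi_partial
  by blast

lemma locally_integrable_mult_test:
  assumes "open \<Omega>" and g: "locally_integrable \<Omega> g" and \<phi>: "\<phi> \<in> test_functions \<Omega>"
  shows "integrable (lebesgue_on \<Omega>) (\<lambda>x. g x * \<phi> x)"
proof -
  obtain K where K: "smooth \<phi>" "compact K" "K \<subseteq> \<Omega>" "\<forall>x. x \<notin> K \<longrightarrow> \<phi> x = 0"
    by (rule test_functionsE[OF \<phi>])
  obtain B where B: "0 \<le> B" "\<forall>x. \<bar>\<phi> x\<bar> \<le> B"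
    by (rule continuous_compact_support_bounded[OF smooth_continuous[OF K(1)] K(2) K(4)[rule_format]])
  have gK: "integrable lebesgue (\<lambda>x. indicator K x *\<^sub>R g x)"
    using g K by (simp add: locally_integrable_def set_integrable_def)
  have m: "\<phi> \<in> borel_measurable lebesgue"
    using test_integrable_lborel[OF \<phi>] by (intro measurable_completion) auto
  have "integrable lebesgue (\<lambda>x. (indicator K x *\<^sub>R g x) * \<phi> x)"
  proof (rule Bochner_Integration.integrable_bound)
    show "integrable lebesgue (\<lambda>x. B * (indicator K x *\<^sub>R g x))" using gK by simp
    show "(\<lambda>x. indicator K x *\<^sub>R g x * \<phi> x) \<in> borel_measurable lebesgue"
      using borel_measurable_integrable[OF gK] m by (rule borel_measurable_times)
    show "AE x in lebesgue. norm (indicator K x *\<^sub>R g x * \<phi> x) \<le> norm (B * (indicator K x *\<^sub>R g x))"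
    proof (rule AE_I2)
      fix x
      have "\<bar>indicator K x * g x\<bar> * \<bar>\<phi> x\<bar> \<le> \<bar>indicator K x * g x\<bar> * B"
        by (rule mult_left_mono[OF B(2)[rule_format]]) simp
      then show "norm (indicator K x *\<^sub>R g x * \<phi> x) \<le> norm (B * (indicator K x *\<^sub>R g x))"
        using B(1) by (simp add: abs_mult mult_ac)
    qed
  qed
  also have "(\<lambda>x. (indicator K x *\<^sub>R g x) * \<phi> x) = (\<lambda>x. if x \<in> \<Omega> then g x * \<phi> x else 0)"
    by (rule ext) (use K(3,4) in \<open>auto simp: indicator_def\<close>)
  finally show ?thesis
    using Lebesgue_Measure.integrable_restrict_UNIV[of \<Omega> "\<lambda>x. g x * \<phi> x"] \<open>open \<Omega>\<close> by simp
qed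

section \<open>Smooth approximations of boxes and the fundamental lemma\<close>

text \<open>For a polynomial \<open>p\<close>, the function \<open>p(1/t) e\<^sup>-\<^sup>c\<^sup>/\<^sup>t\<close>, continued by zero to \<open>t \<le> 0\<close>.  Carrying the
  polynomial along makes the family closed under differentiation, so all of its members are smooth.\<close>

definition flat :: "real \<Rightarrow> real poly \<Rightarrow> real \<Rightarrow> real" where
  "flat c p t = (if t \<le> 0 then 0 else poly p (1 / t) * exp (- (c / t)))"

lemma poly_mult_exp_tendsto_0:
  fixes c :: real
  assumes "0 < c"
  shows "((\<lambda>s. poly p s * exp (- (c * s))) \<longlongrightarrow> 0) at_top"
proof -
  have mono: "((\<lambda>s. s ^ k * exp (- (c * s))) \<longlongrightarrow> 0) at_top" for k
  proof -
    have "filterlim (\<lambda>s. c * s) at_top at_top"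
      using assms by (intro filterlim_tendsto_pos_mult_at_top[OF tendsto_const] filterlim_ident)
    from filterlim_compose[OF tendsto_power_div_exp_0 this]
    have "((\<lambda>s. (1 / c ^ k) * ((c * s) ^ k / exp (c * s))) \<longlongrightarrow> (1 / c ^ k) * 0) at_top"
      by (intro tendsto_intros)
    also have "(\<lambda>s. (1 / c ^ k) * ((c * s) ^ k / exp (c * s))) = (\<lambda>s. s ^ k * exp (- (c * s)))"
      using assms by (simp add: power_mult_distrib exp_minus field_simps)
    finally show ?thesis by simp
  qed
  have "((\<lambda>s. \<Sum>i\<le>degree p. coeff p i * (s ^ i * exp (- (c * s)))) \<longlongrightarrow> (\<Sum>i\<le>degree p. coeff p i * 0)) at_top"
    by (intro tendsto_sum tendsto_mult tendsto_const mono)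
  moreover have "poly p s * exp (- (c * s)) = (\<Sum>i\<le>degree p. coeff p i * (s ^ i * exp (- (c * s))))" for s
    by (simp only: poly_altdef sum_distrib_right mult.assoc)
  ultimately show ?thesis by simp
qed

text \<open>The chain rule accounts for the new polynomial when \<open>t > 0\<close>; at \<open>t = 0\<close> the difference quotient is
  again a polynomial in \<open>1/t\<close> times \<open>e\<^sup>-\<^sup>c\<^sup>/\<^sup>t\<close>, which tends to zero.\<close>

lemma flat_has_derivative:
  assumes "0 < c"
  shows "(flat c p has_real_derivative flat c ([:0, 0, 1:] * (smult c p - pderiv p)) t) (at t)"
proof -
  consider "t < 0" | "t = 0" | "0 < t" by linarith
  then show ?thesis
  proof cases
    case 1
    have "(flat c p has_real_derivative 0) (at t)"
      by (rule DERIV_cong_ev[THEN iffD1, OF refl _ refl DERIV_const[of 0]])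
         (use 1 in \<open>auto simp: flat_def eventually_nhds intro!: exI[of _ "{..<0}"]\<close>)
    with 1 show ?thesis by (simp add: flat_def)
  next
    case 2
    have "((\<lambda>h. flat c p h / h) \<longlongrightarrow> 0) (at_left 0)"
      by (rule tendsto_eventually) (auto simp: eventually_at_filter flat_def)
    moreover have "((\<lambda>h. flat c p h / h) \<longlongrightarrow> 0) (at_right 0)"
    proof (rule Lim_transform_eventually)
      show "((\<lambda>h. poly (pCons 0 p) (inverse h) * exp (- (c * inverse h))) \<longlongrightarrow> 0) (at_right 0)"
        by (rule filterlim_compose[OF poly_mult_exp_tendsto_0[OF assms] filterlim_inverse_at_top_right])
      show "\<forall>\<^sub>F h in at_right 0. poly (pCons 0 p) (inverse h) * exp (- (c * inverse h)) = flat c p h / h"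
        by (auto simp: eventually_at_filter flat_def divide_inverse)
    qed
    ultimately have "((\<lambda>h. flat c p h / h) \<longlongrightarrow> 0) (at 0)"
      by (simp add: filterlim_split_at)
    with 2 show ?thesis by (simp add: DERIV_def flat_def)
  next
    case 3
    have "((\<lambda>t. poly p (1 / t) * exp (- (c / t))) has_real_derivative
        poly p (1 / t) * (exp (- (c / t)) * (c / t\<^sup>2)) + poly (pderiv p) (1 / t) * (- (1 / t\<^sup>2)) * exp (- (c / t))) (at t)"
      using 3 by (auto intro!: derivative_eq_intros DERIV_chain2[OF poly_DERIV] simp: power2_eq_square)
    also have "poly p (1 / t) * (exp (- (c / t)) * (c / t\<^sup>2)) + poly (pderiv p) (1 / t) * (- (1 / t\<^sup>2)) * exp (- (c / t))
       = flat c ([:0, 0, 1:] * (smult c p - pderiv p)) t"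
      using 3 by (simp add: flat_def field_simps power2_eq_square)
    finally show ?thesis
      by (rule DERIV_cong_ev[THEN iffD1, OF refl _ refl, rotated])
         (use 3 in \<open>auto simp: flat_def eventually_nhds intro!: exI[of _ "{0<..}"]\<close>)
  qed
qed

lemma smooth_flat_affine:
  assumes "0 < c"
  shows "smooth (\<lambda>x. flat c p (s * x $ i + d))"
proof (rule smooth_family)
  let ?F = "{\<lambda>x. flat c p (s * x $ i + d) | p. True}"
  define p' where "p' p = [:0, 0, 1:] * (smult c p - pderiv p)" for p
  have der: "((\<lambda>x. flat c p (s * x $ i + d)) has_derivative (\<lambda>h. flat c (p' p) (s * x $ i + d) * (s * h $ i))) (at x)" for p x
  proof -
    have "((\<lambda>x::real^2. s * x $ i + d) has_derivative (\<lambda>h. s * h $ i)) (at x)"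
      by (auto intro!: derivative_eq_intros has_derivative_coordinate)
    moreover have "(flat c p has_derivative (\<lambda>h. flat c (p' p) (s * x $ i + d) * h)) (at (s * x $ i + d))"
      using flat_has_derivative[OF assms] unfolding has_field_derivative_def p'_def .
    ultimately show ?thesis by (rule has_derivative_compose)
  qed
  show "(\<lambda>x. flat c p (s * x $ i + d)) \<in> ?F" by blast
  show "f differentiable_on UNIV" if "f \<in> ?F" for f
    using that der by (fastforce simp: differentiable_on_def differentiable_def)
  show "partial j f \<in> ?F" if f: "f \<in> ?F" for f j
  proof -
    obtain p where p: "f = (\<lambda>x. flat c p (s * x $ i + d))" using f by blast
    have "partial j f = (\<lambda>x. flat c (smult (s * axis j 1 $ i) (p' p)) (s * x $ i + d))"
      unfolding p by (rule ext, subst partial_of_has_derivative[OF der]) (simp add: flat_def)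
    then show ?thesis by blast
  qed
qed

lemma flat_one_bounds: "0 < c \<Longrightarrow> 0 \<le> flat c 1 t \<and> flat c 1 t \<le> 1"
  by (simp add: flat_def)

lemma flat_one_tendsto: "(\<lambda>n. flat (inverse (real (Suc n))) 1 t) \<longlonglongrightarrow> (if 0 < t then 1 else 0)"
proof (cases "0 < t")
  case True
  have "(\<lambda>n. exp (- (inverse (real (Suc n)) / t))) \<longlonglongrightarrow> exp (- (0 / t))"
    by (intro tendsto_intros LIMSEQ_inverse_real_of_nat) (use True in auto)
  with True show ?thesis by (simp add: flat_def)
qed (simp add: flat_def)

text \<open>The function \<open>e\<^sup>-\<^sup>c\<^sup>/\<^sup>t\<close> tends to \<open>1\<close> for every \<open>t > 0\<close> as \<open>c\<close> decreases to \<open>0\<close>.  A product of four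
  such factors, one for each face of the box, is therefore a test function that vanishes outside the
  box and converges to its indicator.\<close>

lemma indicator_box_approximation:
  fixes a b :: "real^2"
  assumes "cbox a b \<subseteq> \<Omega>"
  obtains \<phi> :: "nat \<Rightarrow> real^2 \<Rightarrow> real" where
    "\<And>n. \<phi> n \<in> test_functions \<Omega>" "\<And>n x. \<bar>\<phi> n x\<bar> \<le> indicator (cbox a b) x"
    "\<And>x. (\<lambda>n. \<phi> n x) \<longlonglongrightarrow> indicator (box a b) x"
proof -
  define e where "e n = inverse (real (Suc n))" for n
  have epos: "0 < e n" for n by (simp add: e_def)
  define F where "F n i x = flat (e n) 1 (x $ i - a $ i) * flat (e n) 1 (b $ i - x $ i)" for n i and x :: "real^2"
  define \<phi> where "\<phi> n x = F n 1 x * F n 2 x" for n x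
  have smF: "smooth (F n i)" for n i
  proof -
    have "F n i = (\<lambda>x. flat (e n) 1 (1 * x $ i + (- a $ i)) * flat (e n) 1 ((-1) * x $ i + b $ i))"
      by (simp add: F_def fun_eq_iff)
    then show ?thesis
      by (simp only: smooth_mult smooth_flat_affine epos)
  qed
  have F01: "0 \<le> F n i x" "F n i x \<le> 1" for n i x
    unfolding F_def using flat_one_bounds[OF epos] by (auto intro!: mult_nonneg_nonneg mult_le_one)
  have F0: "F n i x = 0" if "\<not> (a $ i < x $ i \<and> x $ i < b $ i)" for n i x
    using that by (auto simp: F_def flat_def)
  have out: "\<phi> n x = 0" if "x \<notin> box a b" for n x
    using that F0[of 1 x n] F0[of 2 x n] by (auto simp: \<phi>_def mem_box_cart forall_2)
  have sub: "box a b \<subseteq> cbox a b" by (rule box_subset_cbox)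
  show ?thesis
  proof (rule that)
    show "\<phi> n \<in> test_functions \<Omega>" for n
    proof (rule test_functionsI[OF _ compact_cbox assms])
      show "smooth (\<phi> n)"
        using smooth_mult[OF smF smF] unfolding \<phi>_def .
    qed (use out sub in auto)
    show "\<bar>\<phi> n x\<bar> \<le> indicator (cbox a b) x" for n x
    proof (cases "x \<in> cbox a b")
      case True
      have "0 \<le> \<phi> n x" "\<phi> n x \<le> 1"
        unfolding \<phi>_def using F01 by (auto intro!: mult_nonneg_nonneg mult_le_one)
      with True show ?thesis by simp
    qed (use out sub in auto)
    show "(\<lambda>n. \<phi> n x) \<longlonglongrightarrow> indicator (box a b) x" for x
    proof (cases "x \<in> box a b")
      case True
      have "(\<lambda>n. F n i x) \<longlonglongrightarrow> 1 * 1" for i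
        unfolding F_def e_def
        by (intro tendsto_mult flat_one_tendsto[THEN tendsto_eq_rhs]) (use True in \<open>auto simp: mem_box_cart\<close>)
      then have "(\<lambda>n. \<phi> n x) \<longlonglongrightarrow> (1 * 1) * (1 * 1)"
        unfolding \<phi>_def by (intro tendsto_mult)
      with True show ?thesis by simp
    qed (use out in auto)
  qed
qed

text \<open>Dominated convergence along the test functions of \<open>indicator_box_approximation\<close>, with the restriction
  of \<open>g\<close> to the closed box as majorant.\<close>

lemma integral_box_eq_0:
  assumes "open \<Omega>" and g: "locally_integrable \<Omega> g"
    and zero: "\<And>\<phi>. \<phi> \<in> test_functions \<Omega> \<Longrightarrow> (LINT x|lebesgue_on \<Omega>. g x * \<phi> x) = 0"
    and ab: "cbox a b \<subseteq> \<Omega>"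
  shows "(LINT x|lebesgue. indicator (box a b) x * g x) = 0"
proof -
  obtain \<phi> where \<phi>: "\<And>n. \<phi> n \<in> test_functions \<Omega>" "\<And>n x. \<bar>\<phi> n x\<bar> \<le> indicator (cbox a b) x"
    "\<And>x. (\<lambda>n. \<phi> n x) \<longlonglongrightarrow> indicator (box a b) x"
    using indicator_box_approximation[OF ab] by metis
  have out: "\<phi> n x = 0" if "x \<notin> cbox a b" for n x
    using \<phi>(2)[of n x] that by simp
  have gab: "integrable lebesgue (\<lambda>x. indicator (cbox a b) x * g x)"
    using g ab by (simp add: locally_integrable_def set_integrable_def)
  define G where "G = (\<lambda>x. indicator (cbox a b) x * g x)"
  have Gm: "G \<in> borel_measurable lebesgue" using gab by (auto simp: G_def)
  have \<phi>m: "\<phi> n \<in> borel_measurable lebesgue" for n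
    using test_integrable_lborel[OF \<phi>(1)] by (intro measurable_completion) auto
  have z: "(LINT x|lebesgue. G x * \<phi> n x) = 0" for n
  proof -
    have "0 = (LINT x|lebesgue. (if x \<in> \<Omega> then g x * \<phi> n x else 0))"
      using zero[OF \<phi>(1)] \<open>open \<Omega>\<close> by (subst Lebesgue_Measure.integral_restrict_UNIV) auto
    also have "(\<lambda>x. if x \<in> \<Omega> then g x * \<phi> n x else 0) = (\<lambda>x. G x * \<phi> n x)"
      by (rule ext) (use ab out in \<open>auto simp: G_def indicator_def\<close>)
    finally show ?thesis by simp
  qed
  have "(\<lambda>n. LINT x|lebesgue. G x * \<phi> n x) \<longlonglongrightarrow> (LINT x|lebesgue. G x * indicator (box a b) x)"
  proof (rule integral_dominated_convergence[where w = "\<lambda>x. \<bar>G x\<bar>"])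
    show "(\<lambda>x. G x * indicator (box a b) x) \<in> borel_measurable lebesgue"
      using Gm by (intro borel_measurable_times borel_measurable_indicator) auto
    show "(\<lambda>x. G x * \<phi> n x) \<in> borel_measurable lebesgue" for n
      using Gm \<phi>m by (intro borel_measurable_times)
    show "integrable lebesgue (\<lambda>x. \<bar>G x\<bar>)" using gab by (simp add: G_def)
    show "AE x in lebesgue. (\<lambda>n. G x * \<phi> n x) \<longlonglongrightarrow> G x * indicator (box a b) x"
      by (intro AE_I2 tendsto_mult tendsto_const \<phi>(3))
    show "AE x in lebesgue. norm (G x * \<phi> n x) \<le> \<bar>G x\<bar>" for n
    proof (rule AE_I2)
      fix x
      have "\<bar>\<phi> n x\<bar> \<le> 1" by (rule order_trans[OF \<phi>(2)]) (simp add: indicator_def)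
      then show "norm (G x * \<phi> n x) \<le> \<bar>G x\<bar>"
        by (simp add: abs_mult mult_left_le)
    qed
  qed
  then have "(LINT x|lebesgue. G x * indicator (box a b) x) = 0"
    unfolding z by (rule LIMSEQ_unique) (rule tendsto_const)
  also have "(\<lambda>x. G x * indicator (box a b) x) = (\<lambda>x. indicator (box a b) x * g x)"
    using box_subset_cbox[of a b] by (auto simp: G_def indicator_def fun_eq_iff)
  finally show ?thesis .
qed

text \<open>The boxes form an intersection-stable generator of the Borel sets, and Dynkin's argument extends
  the vanishing of the integral from boxes to all Borel sets.  It is carried out for a Borel function
  \<open>G'\<close> that represents \<open>g\<close> on the given box.\<close>

lemma AE_eq_0_on_box:
  fixes g :: "real^2 \<Rightarrow> real"
  assumes int: "integrable lebesgue (\<lambda>x. indicator (box c d) x * g x)"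
    and zero: "\<And>a b. cbox a b \<subseteq> cbox c d \<Longrightarrow> (LINT x|lebesgue. indicator (box a b) x * g x) = 0"
  shows "AE x in lebesgue. x \<in> box c d \<longrightarrow> g x = 0"
proof -
  define G where "G = (\<lambda>x. indicator (box c d) x * g x)"
  have Gm: "G \<in> borel_measurable (completion lborel)" using int by (auto simp: G_def)
  obtain G' where G'm: "G' \<in> borel_measurable lborel" and GG': "AE x in lborel. G x = G' x"
    using completion_ex_borel_measurable_real[OF Gm] by blast
  have GG'c: "AE x in lebesgue. G x = G' x" using GG' by (rule AE_completion)
  have "integrable lebesgue G'"
    using int integrable_cong_AE[OF Gm measurable_completion[OF G'm] GG'c] by (simp add: G_def)
  then have G'i: "integrable lborel G'"
    using G'm by (simp add: integrable_completion)
  have all: "(LINT x:A|lborel. G' x) = (LINT x|lebesgue. indicator A x * G x)" if "A \<in> sets borel" for A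
  proof -
    have "(LINT x:A|lborel. G' x) = (LINT x|lebesgue. indicator A x * G' x)"
      unfolding set_lebesgue_integral_def using that G'm by (subst integral_completion) auto
    also have "\<dots> = (LINT x|lebesgue. indicator A x * G x)"
    proof (rule integral_cong_AE)
      show "(\<lambda>x. indicator A x * G' x) \<in> borel_measurable lebesgue"
        using that G'm by (intro measurable_completion) auto
      show "(\<lambda>x. indicator A x * G x) \<in> borel_measurable lebesgue"
        using that Gm by (intro borel_measurable_times borel_measurable_indicator) auto
    qed (use GG'c in auto)
    finally show ?thesis .
  qed
  have box: "(LINT x:box u v|lborel. G' x) = 0" for u v
  proof -
    \<comment> \<open>The intersection of two boxes is a box, so the hypothesis covers it.\<close>
    define a where "a = (\<Sum>i\<in>Basis. max (u \<bullet> i) (c \<bullet> i) *\<^sub>R i)"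
    define b where "b = (\<Sum>i\<in>Basis. min (v \<bullet> i) (d \<bullet> i) *\<^sub>R i)"
    have "box u v \<inter> box c d = box a b"
      unfolding a_def b_def by (rule box_Int_box)
    then have "(\<lambda>x. indicator (box u v) x * G x) = (\<lambda>x. indicator (box a b) x * g x)"
      by (auto simp: G_def indicator_def fun_eq_iff)
    moreover have "cbox a b \<subseteq> cbox c d"
      unfolding a_def b_def by (auto simp: mem_box)
    ultimately show ?thesis using all[of "box u v"] zero by simp
  qed
  have uni: "(LINT x:UNIV|lborel. G' x) = 0"
    using zero[of c d] all[of UNIV] by (simp add: G_def)
  have "(LINT x:A|lborel. G' x) = 0" if "A \<in> sets lborel" for A
  proof -
    let ?E = "range (\<lambda>(a, b). box a b :: (real^2) set)"
    have sb: "sigma_sets UNIV ?E = sets borel" by (simp add: borel_eq_box)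
    have "Int_stable ?E" by (auto simp: Int_stable_def box_Int_box)
    moreover have "?E \<subseteq> Pow UNIV" by simp
    moreover have "A \<in> sigma_sets UNIV ?E" using that sb by simp
    ultimately show ?thesis
    proof (induction rule: sigma_sets_induct_disjoint)
      case (basic A)
      then show ?case using box by auto
    next
      case empty
      then show ?case by (simp add: set_lebesgue_integral_def)
    next
      case (compl A)
      then have A: "A \<in> sets lborel" by (simp add: sb)
      have "(LINT x:(UNIV - A) \<union> A|lborel. G' x) = (LINT x:UNIV - A|lborel. G' x) + (LINT x:A|lborel. G' x)"
        by (rule set_integral_Un, blast; unfold set_integrable_def; rule integrable_mult_indicator)
           (use A G'i in auto)
      then show ?case using uni compl by simp
    next
      case (union A)
      then have A: "\<And>i. A i \<in> sets lborel" by (auto simp: sb)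
      have "(LINT x:(\<Union>i. A i)|lborel. G' x) = (\<Sum>i. (LINT x:A i|lborel. G' x))"
      proof (rule lebesgue_integral_countable_add)
        show "set_integrable lborel (\<Union>i. A i) G'"
          unfolding set_integrable_def using A G'i by (intro integrable_mult_indicator) auto
        show "A i \<inter> A j = {}" if "i \<noteq> j" for i j
          using union that by (auto simp: disjoint_family_on_def)
      qed (use A in auto)
      then show ?case using union by simp
    qed
  qed
  then have "AE x in lborel. G' x = 0"
    by (intro density_unique_real[OF G'i, of "\<lambda>_. 0"]) (auto simp: set_lebesgue_integral_def)
  with GG' have "AE x in lborel. G x = 0" by eventually_elim simp
  then have "AE x in lebesgue. G x = 0" by (rule AE_completion)
  then show ?thesis by eventually_elim (auto simp: G_def)
qed

text \<open>The fundamental lemma of the calculus of variations.  The domain is a countable union of closed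
  boxes, so it is enough to argue on each of them.\<close>

lemma fundamental_lemma:
  assumes "open \<Omega>" and g: "locally_integrable \<Omega> g"
    and zero: "\<And>\<phi>. \<phi> \<in> test_functions \<Omega> \<Longrightarrow> (LINT x|lebesgue_on \<Omega>. g x * \<phi> x) = 0"
  shows "AE x in lebesgue_on \<Omega>. g x = 0"
proof -
  define l where "l f = (\<Sum>(i::real^2)\<in>Basis. fst (f i :: real \<times> real) *\<^sub>R i)" for f
  define u where "u f = (\<Sum>(i::real^2)\<in>Basis. snd (f i :: real \<times> real) *\<^sub>R i)" for f
  define I where "I = {f \<in> (Basis :: (real^2) set) \<rightarrow>\<^sub>E \<rat> \<times> \<rat>. cbox (l f) (u f) \<subseteq> \<Omega>}"
  have cover: "\<Omega> = (\<Union>f\<in>I. cbox (l f) (u f))"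
    unfolding I_def l_def u_def by (rule open_UNION_cbox[OF assms(1)])
  have "countable ((Basis :: (real^2) set) \<rightarrow>\<^sub>E (\<rat> \<times> \<rat> :: (real \<times> real) set))"
    by (intro countable_PiE countable_SIGMA) (auto simp: countable_rat)
  then have "countable I" by (rule countable_subset[rotated]) (auto simp: I_def)
  have "AE x in lebesgue. x \<in> cbox (l f) (u f) \<longrightarrow> g x = 0" if "f \<in> I" for f
  proof -
    have sub: "cbox (l f) (u f) \<subseteq> \<Omega>" using that by (simp add: I_def)
    have "g absolutely_integrable_on cbox (l f) (u f)"
      using g sub by (simp add: locally_integrable_def)
    then have "g absolutely_integrable_on box (l f) (u f)"
      by (simp add: absolutely_integrable_on_open_interval)
    then have "integrable lebesgue (\<lambda>x. indicator (box (l f) (u f)) x * g x)"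
      by (simp add: set_integrable_def)
    then have "AE x in lebesgue. x \<in> box (l f) (u f) \<longrightarrow> g x = 0"
      by (rule AE_eq_0_on_box) (use sub in \<open>auto intro!: integral_box_eq_0[OF assms]\<close>)
    moreover have "cbox (l f) (u f) - box (l f) (u f) \<in> null_sets lebesgue"
      using negligible_frontier_interval by (simp add: negligible_iff_null_sets)
    then have "AE x in lebesgue. x \<notin> cbox (l f) (u f) - box (l f) (u f)"
      by (rule AE_not_in)
    ultimately show ?thesis by eventually_elim auto
  qed
  then have "AE x in lebesgue. \<forall>f\<in>I. x \<in> cbox (l f) (u f) \<longrightarrow> g x = 0"
    by (subst AE_ball_countable[OF \<open>countable I\<close>]) blast
  then have "AE x in lebesgue. x \<in> \<Omega> \<longrightarrow> g x = 0"
    by eventually_elim (use cover in blast)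
  then show ?thesis
    using assms(1) by (simp add: AE_restrict_space_iff)
qed

section \<open>The space of square integrable functions\<close>

definition L2_inner :: "(real^2) set \<Rightarrow> (real^2 \<Rightarrow> real) \<Rightarrow> (real^2 \<Rightarrow> real) \<Rightarrow> real" where
  "L2_inner \<Omega> f g = (LINT x|lebesgue_on \<Omega>. f x * g x)"

definition L2_norm :: "(real^2) set \<Rightarrow> (real^2 \<Rightarrow> real) \<Rightarrow> real" where
  "L2_norm \<Omega> f = sqrt (LINT x|lebesgue_on \<Omega>. (f x)\<^sup>2)"

lemma L2_measurable: "f \<in> L2_space \<Omega> \<Longrightarrow> f \<in> borel_measurable (lebesgue_on \<Omega>)"
  by (simp add: L2_space_def)

lemma L2_square_integrable: "f \<in> L2_space \<Omega> \<Longrightarrow> integrable (lebesgue_on \<Omega>) (\<lambda>x. (f x)\<^sup>2)"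
  by (simp add: L2_space_def)

lemma L2_mult_integrable:
  assumes "f \<in> L2_space \<Omega>" "g \<in> L2_space \<Omega>"
  shows "integrable (lebesgue_on \<Omega>) (\<lambda>x. f x * g x)"
proof (rule Bochner_Integration.integrable_bound)
  show "integrable (lebesgue_on \<Omega>) (\<lambda>x. (f x)\<^sup>2 + (g x)\<^sup>2)"
    by (intro Bochner_Integration.integrable_add L2_square_integrable assms)
  show "(\<lambda>x. f x * g x) \<in> borel_measurable (lebesgue_on \<Omega>)"
    by (intro borel_measurable_times L2_measurable assms)
  have "\<bar>a * b\<bar> \<le> \<bar>a\<^sup>2 + b\<^sup>2\<bar>" for a b :: real
  proof -
    have "2 * (\<bar>a\<bar> * \<bar>b\<bar>) \<le> a\<^sup>2 + b\<^sup>2"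
      using sum_squares_bound[of "\<bar>a\<bar>" "\<bar>b\<bar>"] by simp
    moreover have "0 \<le> \<bar>a\<bar> * \<bar>b\<bar>" by simp
    ultimately have "\<bar>a\<bar> * \<bar>b\<bar> \<le> a\<^sup>2 + b\<^sup>2" by linarith
    then show ?thesis by (simp add: abs_mult)
  qed
  then show "AE x in lebesgue_on \<Omega>. norm (f x * g x) \<le> norm ((f x)\<^sup>2 + (g x)\<^sup>2)"
    by simp
qed

lemma L2_add:
  assumes "f \<in> L2_space \<Omega>" "g \<in> L2_space \<Omega>"
  shows "(\<lambda>x. f x + g x) \<in> L2_space \<Omega>"
proof -
  have "integrable (lebesgue_on \<Omega>) (\<lambda>x. (f x)\<^sup>2 + (g x)\<^sup>2 + 2 * (f x * g x))"
    by (intro Bochner_Integration.integrable_add L2_square_integrable integrable_mult_right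
        L2_mult_integrable assms)
  then show ?thesis
    using assms by (simp add: L2_space_def power2_sum mult.assoc borel_measurable_add)
qed

lemma L2_cmult: "f \<in> L2_space \<Omega> \<Longrightarrow> (\<lambda>x. c * f x) \<in> L2_space \<Omega>"
  by (simp add: L2_space_def power_mult_distrib borel_measurable_times)

lemma L2_diff:
  assumes "f \<in> L2_space \<Omega>" "g \<in> L2_space \<Omega>"
  shows "(\<lambda>x. f x - g x) \<in> L2_space \<Omega>"
  using L2_add[OF assms(1) L2_cmult[OF assms(2), of "-1"]] by simp

lemma L2_test:
  assumes "open \<Omega>" "\<phi> \<in> test_functions \<Omega>"
  shows "\<phi> \<in> L2_space \<Omega>"
proof -
  have "integrable (lebesgue_on \<Omega>) (\<lambda>x. (\<phi> x)\<^sup>2)"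
    unfolding power2_eq_square
    by (intro test_integrable_on test_smooth_mult test_smooth[OF assms(2)] assms)
  then show ?thesis
    using test_integrable_on[OF assms] by (auto simp: L2_space_def)
qed

text \<open>Completeness of Lebesgue measure makes the function \<open>g\<close> measurable.\<close>

lemma L2_cong_AE:
  assumes "open \<Omega>" "f \<in> L2_space \<Omega>" and ae: "AE x in lebesgue_on \<Omega>. f x = g x"
  shows "g \<in> L2_space \<Omega>"
proof -
  have \<Omega>: "\<Omega> \<in> sets lebesgue" using assms(1) by auto
  have "(\<lambda>x. if x \<in> \<Omega> then f x else 0) \<in> borel_measurable lebesgue"
    using L2_measurable[OF assms(2)] \<Omega> by (simp add: borel_measurable_if)
  moreover have "AE x in lebesgue. (if x \<in> \<Omega> then f x else 0) = (if x \<in> \<Omega> then g x else 0)"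
  proof -
    have "AE x in lebesgue. x \<in> \<Omega> \<longrightarrow> f x = g x"
      using ae \<Omega> by (simp add: AE_restrict_space_iff)
    then show ?thesis by eventually_elim auto
  qed
  ultimately have "(\<lambda>x. if x \<in> \<Omega> then g x else 0) \<in> borel_measurable lebesgue"
    by (rule borel_measurable_AE)
  then have g: "g \<in> borel_measurable (lebesgue_on \<Omega>)"
    using \<Omega> by (simp add: borel_measurable_if)
  have "integrable (lebesgue_on \<Omega>) (\<lambda>x. (g x)\<^sup>2)"
    by (rule integrable_cong_AE_imp[OF L2_square_integrable[OF assms(2)]])
       (use g ae in auto)
  with g show ?thesis by (simp add: L2_space_def)
qed

lemma L2_norm_nonneg: "0 \<le> L2_norm \<Omega> f"
  by (simp add: L2_norm_def)

lemma L2_norm_square: "(L2_norm \<Omega> f)\<^sup>2 = L2_inner \<Omega> f f"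
  by (simp add: L2_norm_def L2_inner_def power2_eq_square[of "f _"])

lemma L2_inner_diff_left:
  assumes "f \<in> L2_space \<Omega>" "g \<in> L2_space \<Omega>" "h \<in> L2_space \<Omega>"
  shows "L2_inner \<Omega> (\<lambda>x. f x - g x) h = L2_inner \<Omega> f h - L2_inner \<Omega> g h"
  unfolding L2_inner_def left_diff_distrib
  by (intro Bochner_Integration.integral_diff L2_mult_integrable assms)

text \<open>This quadratic polynomial in \<open>t\<close> yields both the Cauchy-Schwarz and the triangle inequality.\<close>

lemma L2_norm_add_cmult_square:
  assumes "f \<in> L2_space \<Omega>" "g \<in> L2_space \<Omega>"
  shows "(L2_norm \<Omega> (\<lambda>x. f x + t * g x))\<^sup>2
    = (L2_norm \<Omega> f)\<^sup>2 + 2 * t * L2_inner \<Omega> f g + t\<^sup>2 * (L2_norm \<Omega> g)\<^sup>2"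
proof -
  have "(L2_norm \<Omega> (\<lambda>x. f x + t * g x))\<^sup>2
      = (LINT x|lebesgue_on \<Omega>. f x * f x + (2 * t) * (f x * g x) + t\<^sup>2 * (g x * g x))"
    unfolding L2_norm_square L2_inner_def by (simp add: algebra_simps power2_eq_square)
  also have "\<dots> = (L2_norm \<Omega> f)\<^sup>2 + 2 * t * L2_inner \<Omega> f g + t\<^sup>2 * (L2_norm \<Omega> g)\<^sup>2"
    unfolding L2_norm_square L2_inner_def
    by (simp add: L2_mult_integrable assms)
  finally show ?thesis .
qed

lemma L2_Cauchy_Schwarz:
  assumes f: "f \<in> L2_space \<Omega>" and g: "g \<in> L2_space \<Omega>"
  shows "\<bar>L2_inner \<Omega> f g\<bar> \<le> L2_norm \<Omega> f * L2_norm \<Omega> g"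
proof -
  define A where "A = (L2_norm \<Omega> f)\<^sup>2"
  define B where "B = (L2_norm \<Omega> g)\<^sup>2"
  define C where "C = L2_inner \<Omega> f g"
  have pos: "0 \<le> A + 2 * t * C + t\<^sup>2 * B" for t
    unfolding A_def B_def C_def L2_norm_add_cmult_square[OF f g, symmetric] by simp
  have "C\<^sup>2 \<le> A * B"
  proof (cases "B = 0")
    case True
    have "C = 0"
    proof (rule ccontr)
      assume "C \<noteq> 0"
      \<comment> \<open>The polynomial is linear in \<open>t\<close>; here it takes the value \<open>-1\<close>.\<close>
      then have "2 * (- (A + 1) / (2 * C)) * C = - (A + 1)" by simp
      with pos[of "- (A + 1) / (2 * C)"] True show False by simp
    qed
    with True show ?thesis by simp
  next
    case False
    then have "0 < B" by (simp add: B_def)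
    \<comment> \<open>The minimum of the polynomial in \<open>t\<close>.\<close>
    with pos[of "- C / B"] show ?thesis
      by (simp add: field_simps power2_eq_square)
  qed
  then have "C\<^sup>2 \<le> (L2_norm \<Omega> f * L2_norm \<Omega> g)\<^sup>2"
    by (simp add: A_def B_def power_mult_distrib)
  then show ?thesis
    unfolding C_def[symmetric] by (rule abs_le_square_iff[THEN iffD2, THEN order_trans])
      (simp add: L2_norm_nonneg)
qed

lemma L2_norm_triangle:
  assumes f: "f \<in> L2_space \<Omega>" and g: "g \<in> L2_space \<Omega>"
  shows "L2_norm \<Omega> (\<lambda>x. f x + g x) \<le> L2_norm \<Omega> f + L2_norm \<Omega> g"
proof (rule power2_le_imp_le)
  show "(L2_norm \<Omega> (\<lambda>x. f x + g x))\<^sup>2 \<le> (L2_norm \<Omega> f + L2_norm \<Omega> g)\<^sup>2"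
    using L2_norm_add_cmult_square[OF f g, of 1] L2_Cauchy_Schwarz[OF f g]
    by (simp add: power2_sum)
qed (simp add: L2_norm_nonneg)

lemma L2_inner_tendsto:
  assumes F: "\<And>n. F n \<in> L2_space \<Omega>" "f \<in> L2_space \<Omega>" "g \<in> L2_space \<Omega>"
    and lim: "(\<lambda>n. L2_norm \<Omega> (\<lambda>x. f x - F n x)) \<longlonglongrightarrow> 0"
  shows "(\<lambda>n. L2_inner \<Omega> (F n) g) \<longlonglongrightarrow> L2_inner \<Omega> f g"
proof -
  have "(\<lambda>n. L2_inner \<Omega> f g - L2_inner \<Omega> (F n) g) \<longlonglongrightarrow> 0"
  proof (rule tendsto_rabs_zero_cancel, rule tendsto_sandwich[OF _ _ tendsto_const])
    show "(\<lambda>n. L2_norm \<Omega> (\<lambda>x. f x - F n x) * L2_norm \<Omega> g) \<longlonglongrightarrow> 0"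
      using tendsto_mult_left_zero[OF lim] .
    show "\<forall>\<^sub>F n in sequentially. \<bar>L2_inner \<Omega> f g - L2_inner \<Omega> (F n) g\<bar>
        \<le> L2_norm \<Omega> (\<lambda>x. f x - F n x) * L2_norm \<Omega> g"
      using L2_Cauchy_Schwarz[OF L2_diff[OF F(2) F(1)] F(3)]
      by (simp add: L2_inner_diff_left F)
  qed simp
  from tendsto_diff[OF tendsto_const[of "L2_inner \<Omega> f g"] this] show ?thesis by simp
qed

lemma L2_norm_tendsto:
  assumes F: "\<And>n. F n \<in> L2_space \<Omega>" "f \<in> L2_space \<Omega>"
    and lim: "(\<lambda>n. L2_norm \<Omega> (\<lambda>x. f x - F n x)) \<longlonglongrightarrow> 0"
  shows "(\<lambda>n. L2_norm \<Omega> (F n)) \<longlonglongrightarrow> L2_norm \<Omega> f"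
proof -
  have neg: "L2_norm \<Omega> (\<lambda>x. F n x - f x) = L2_norm \<Omega> (\<lambda>x. f x - F n x)" for n
    by (simp add: L2_norm_def power2_commute)
  have "\<bar>L2_norm \<Omega> f - L2_norm \<Omega> (F n)\<bar> \<le> L2_norm \<Omega> (\<lambda>x. f x - F n x)" for n
    using L2_norm_triangle[OF L2_diff[OF F(2) F(1)] F(1), of n n]
      L2_norm_triangle[OF L2_diff[OF F(1) F(2)] F(2), of n] neg[of n]
    by simp
  then have "(\<lambda>n. L2_norm \<Omega> f - L2_norm \<Omega> (F n)) \<longlonglongrightarrow> 0"
    by (intro tendsto_rabs_zero_cancel[OF tendsto_sandwich[OF _ _ tendsto_const lim]]) auto
  from tendsto_diff[OF tendsto_const[of "L2_norm \<Omega> f"] this] show ?thesis by simp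
qed

section \<open>Weak derivatives\<close>

lemma locally_integrable_diff:
  "locally_integrable \<Omega> f \<Longrightarrow> locally_integrable \<Omega> g \<Longrightarrow> locally_integrable \<Omega> (\<lambda>x. f x - g x)"
  unfolding locally_integrable_def by (blast intro: set_integral_diff(1))

lemma locally_integrable_lincomb:
  "locally_integrable \<Omega> f \<Longrightarrow> locally_integrable \<Omega> g \<Longrightarrow> locally_integrable \<Omega> (\<lambda>x. c * f x + d * g x)"
  unfolding locally_integrable_def
  by (auto intro!: set_integral_add(1))

lemma weak_deriv_unique:
  assumes "open \<Omega>" and g: "is_weak_deriv \<Omega> \<alpha> f g" and h: "is_weak_deriv \<Omega> \<alpha> f h"
  shows "AE x in lebesgue_on \<Omega>. g x = h x"
proof -
  have li: "locally_integrable \<Omega> g" "locally_integrable \<Omega> h"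
    using g h by (auto simp: is_weak_deriv_def)
  have "AE x in lebesgue_on \<Omega>. g x - h x = 0"
  proof (rule fundamental_lemma[OF assms(1) locally_integrable_diff[OF li]])
    fix \<phi> assume \<phi>: "\<phi> \<in> test_functions \<Omega>"
    have "(LINT x|lebesgue_on \<Omega>. (g x - h x) * \<phi> x)
        = (LINT x|lebesgue_on \<Omega>. g x * \<phi> x) - (LINT x|lebesgue_on \<Omega>. h x * \<phi> x)"
      unfolding left_diff_distrib
      by (intro Bochner_Integration.integral_diff locally_integrable_mult_test assms(1) li \<phi>)
    also have "\<dots> = 0"
      using g h \<phi> by (simp add: is_weak_deriv_def)
    finally show "(LINT x|lebesgue_on \<Omega>. (g x - h x) * \<phi> x) = 0" .
  qed
  then show ?thesis by simp
qed

lemma weak_deriv_is_weak_deriv: "is_weak_deriv \<Omega> \<alpha> f g \<Longrightarrow> is_weak_deriv \<Omega> \<alpha> f (weak_deriv \<Omega> \<alpha> f)"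
  unfolding weak_deriv_def by (rule someI[where P = "is_weak_deriv \<Omega> \<alpha> f"])

text \<open>The choice made in the definition of \<open>weak_deriv\<close> is harmless: any weak derivative that is known
  explicitly may be put in its place.\<close>

lemma weak_deriv_AE_eq:
  "open \<Omega> \<Longrightarrow> is_weak_deriv \<Omega> \<alpha> f g \<Longrightarrow> AE x in lebesgue_on \<Omega>. weak_deriv \<Omega> \<alpha> f x = g x"
  by (blast intro: weak_deriv_unique weak_deriv_is_weak_deriv)

lemma is_weak_deriv_lincomb:
  assumes "open \<Omega>" and f: "is_weak_deriv \<Omega> \<alpha> f f'" and g: "is_weak_deriv \<Omega> \<alpha> g g'"
  shows "is_weak_deriv \<Omega> \<alpha> (\<lambda>x. c * f x + d * g x) (\<lambda>x. c * f' x + d * g' x)"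
proof -
  have li: "locally_integrable \<Omega> f" "locally_integrable \<Omega> f'" "locally_integrable \<Omega> g" "locally_integrable \<Omega> g'"
    using f g by (auto simp: is_weak_deriv_def)
  have sum: "(LINT x|lebesgue_on \<Omega>. (c * u x + d * w x) * \<phi> x)
      = c * (LINT x|lebesgue_on \<Omega>. u x * \<phi> x) + d * (LINT x|lebesgue_on \<Omega>. w x * \<phi> x)"
    if "locally_integrable \<Omega> u" "locally_integrable \<Omega> w" "\<phi> \<in> test_functions \<Omega>" for u w \<phi>
    unfolding distrib_right mult.assoc
    using locally_integrable_mult_test[OF assms(1) that(1,3)] locally_integrable_mult_test[OF assms(1) that(2,3)]
    by simp
  show ?thesis
    unfolding is_weak_deriv_def
    using f g by (auto simp: sum li test_multi_partial locally_integrable_lincomb is_weak_deriv_def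
        distrib_left mult.left_commute)
qed

lemma sobolev_is_weak_deriv:
  "f \<in> sobolev m \<Omega> \<Longrightarrow> ord_mi \<alpha> \<le> m \<Longrightarrow> is_weak_deriv \<Omega> \<alpha> f (weak_deriv \<Omega> \<alpha> f)"
  unfolding sobolev_def using weak_deriv_is_weak_deriv by blast

lemma sobolev_weak_deriv_L2:
  assumes "open \<Omega>" "f \<in> sobolev m \<Omega>" "ord_mi \<alpha> \<le> m"
  shows "weak_deriv \<Omega> \<alpha> f \<in> L2_space \<Omega>"
proof -
  obtain g where "g \<in> L2_space \<Omega>" "is_weak_deriv \<Omega> \<alpha> f g"
    using assms unfolding sobolev_def by blast
  then show ?thesis
    using L2_cong_AE[OF assms(1)] weak_deriv_unique[OF assms(1) _ weak_deriv_is_weak_deriv] by blast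
qed

lemma is_weak_deriv_zero_order:
  "locally_integrable \<Omega> f \<Longrightarrow> is_weak_deriv \<Omega> (0, 0) f f"
  by (simp add: is_weak_deriv_def multi_partial_def ord_mi_def)

lemma sobolev_weak_deriv_zero_order:
  assumes "open \<Omega>" "f \<in> sobolev m \<Omega>"
  shows "AE x in lebesgue_on \<Omega>. weak_deriv \<Omega> (0, 0) f x = f x"
proof -
  have "is_weak_deriv \<Omega> (0, 0) f (weak_deriv \<Omega> (0, 0) f)"
    using assms(2) by (rule sobolev_is_weak_deriv) (simp add: ord_mi_def)
  then show ?thesis
    using assms(1) by (intro weak_deriv_AE_eq is_weak_deriv_zero_order) (auto simp: is_weak_deriv_def)
qed

lemma ord_mi_add: "ord_mi (\<alpha> + \<beta>) = ord_mi \<alpha> + ord_mi \<beta>"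
  by (simp add: ord_mi_def)

text \<open>Iterating weak derivatives moves all classical derivatives onto the test function, where they
  commute.\<close>

lemma sobolev_weak_deriv_weak_deriv:
  assumes f: "f \<in> sobolev m \<Omega>" and ord: "ord_mi \<alpha> + ord_mi \<beta> \<le> m"
  shows "is_weak_deriv \<Omega> \<beta> (weak_deriv \<Omega> \<alpha> f) (weak_deriv \<Omega> (\<beta> + \<alpha>) f)"
proof -
  have a: "is_weak_deriv \<Omega> \<alpha> f (weak_deriv \<Omega> \<alpha> f)"
    and ab: "is_weak_deriv \<Omega> (\<beta> + \<alpha>) f (weak_deriv \<Omega> (\<beta> + \<alpha>) f)"
    using ord by (auto intro!: sobolev_is_weak_deriv[OF f] simp: ord_mi_add)
  have "(LINT x|lebesgue_on \<Omega>. weak_deriv \<Omega> \<alpha> f x * multi_partial \<beta> \<phi> x)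
      = (-1) ^ ord_mi \<beta> * (LINT x|lebesgue_on \<Omega>. weak_deriv \<Omega> (\<beta> + \<alpha>) f x * \<phi> x)"
    if \<phi>: "\<phi> \<in> test_functions \<Omega>" for \<phi>
  proof -
    let ?s = "(-1 :: real) ^ ord_mi \<alpha>"
    have "?s * (LINT x|lebesgue_on \<Omega>. weak_deriv \<Omega> \<alpha> f x * multi_partial \<beta> \<phi> x)
        = (LINT x|lebesgue_on \<Omega>. f x * multi_partial \<alpha> (multi_partial \<beta> \<phi>) x)"
      using a test_multi_partial[OF \<phi>, of \<beta>] by (simp add: is_weak_deriv_def)
    also have "\<dots> = (LINT x|lebesgue_on \<Omega>. f x * multi_partial (\<beta> + \<alpha>) \<phi> x)"
      by (simp only: multi_partial_multi_partial[OF test_smooth[OF \<phi>]] add.commute[of \<alpha> \<beta>])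
    also have "\<dots> = ?s * ((-1) ^ ord_mi \<beta> * (LINT x|lebesgue_on \<Omega>. weak_deriv \<Omega> (\<beta> + \<alpha>) f x * \<phi> x))"
      using ab \<phi> by (simp add: is_weak_deriv_def ord_mi_add power_add)
    finally show ?thesis by simp
  qed
  with a ab show ?thesis by (simp add: is_weak_deriv_def)
qed

section \<open>Density of test functions and its consequences\<close>

lemma finite_ord_mi: "finite {\<alpha>. ord_mi \<alpha> = k}"
  by (rule finite_subset[of _ "{..k} \<times> {..k}"]) (auto simp: ord_mi_def)

lemma L2_norm_square_integral: "(L2_norm \<Omega> f)\<^sup>2 = (LINT x|lebesgue_on \<Omega>. (f x)\<^sup>2)"
  by (simp add: L2_norm_def)

lemma sobolev_seminorm_square:
  assumes "open \<Omega>" "f \<in> sobolev m \<Omega>" "k \<le> m"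
  shows "(sobolev_seminorm k \<Omega> f)\<^sup>2 = (\<Sum>\<alpha> | ord_mi \<alpha> = k. (L2_norm \<Omega> (weak_deriv \<Omega> \<alpha> f))\<^sup>2)"
proof -
  have "(sobolev_seminorm k \<Omega> f)\<^sup>2 = (LINT x|lebesgue_on \<Omega>. (\<Sum>\<alpha> | ord_mi \<alpha> = k. \<bar>weak_deriv \<Omega> \<alpha> f x\<bar>\<^sup>2))"
    by (simp add: sobolev_seminorm_def sum_nonneg)
  also have "\<dots> = (\<Sum>\<alpha> | ord_mi \<alpha> = k. (LINT x|lebesgue_on \<Omega>. (weak_deriv \<Omega> \<alpha> f x)\<^sup>2))"
    unfolding power2_abs
    by (rule Bochner_Integration.integral_sum)
       (use assms in \<open>auto intro!: L2_square_integrable sobolev_weak_deriv_L2\<close>)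
  finally show ?thesis by (simp add: L2_norm_square_integral)
qed

lemma sobolev_norm_square: "(sobolev_norm m \<Omega> f)\<^sup>2 = (\<Sum>k\<le>m. (sobolev_seminorm k \<Omega> f)\<^sup>2)"
  by (simp add: sobolev_norm_def sum_nonneg)

lemma L2_norm_weak_deriv_le:
  assumes "open \<Omega>" "f \<in> sobolev m \<Omega>" "ord_mi \<alpha> \<le> m"
  shows "L2_norm \<Omega> (weak_deriv \<Omega> \<alpha> f) \<le> sobolev_norm m \<Omega> f"
proof (rule power2_le_imp_le)
  have "(L2_norm \<Omega> (weak_deriv \<Omega> \<alpha> f))\<^sup>2 \<le> (sobolev_seminorm (ord_mi \<alpha>) \<Omega> f)\<^sup>2"
    unfolding sobolev_seminorm_square[OF assms]
    by (rule member_le_sum) (auto simp: finite_ord_mi)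
  also have "\<dots> \<le> (sobolev_norm m \<Omega> f)\<^sup>2"
    unfolding sobolev_norm_square using assms(3)
    by (intro member_le_sum[where f = "\<lambda>k. (sobolev_seminorm k \<Omega> f)\<^sup>2"]) auto
  finally show "(L2_norm \<Omega> (weak_deriv \<Omega> \<alpha> f))\<^sup>2 \<le> (sobolev_norm m \<Omega> f)\<^sup>2" .
  show "0 \<le> sobolev_norm m \<Omega> f"
    by (simp add: sobolev_norm_def sum_nonneg)
qed

lemma L2_norm_cong_AE:
  assumes "f \<in> L2_space \<Omega>" "g \<in> L2_space \<Omega>" "AE x in lebesgue_on \<Omega>. f x = g x"
  shows "L2_norm \<Omega> f = L2_norm \<Omega> g"
proof -
  have "(LINT x|lebesgue_on \<Omega>. (f x)\<^sup>2) = (LINT x|lebesgue_on \<Omega>. (g x)\<^sup>2)"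
  proof (rule integral_cong_AE)
    show "AE x in lebesgue_on \<Omega>. (f x)\<^sup>2 = (g x)\<^sup>2" using assms(3) by eventually_elim simp
  qed (use L2_square_integrable assms in auto)
  then show ?thesis by (simp add: L2_norm_def)
qed

lemma is_weak_deriv_diff_test:
  assumes "open \<Omega>" "f \<in> sobolev m \<Omega>" "\<phi> \<in> test_functions \<Omega>" "ord_mi \<alpha> \<le> m"
  shows "is_weak_deriv \<Omega> \<alpha> (\<lambda>x. f x - \<phi> x) (\<lambda>x. weak_deriv \<Omega> \<alpha> f x - multi_partial \<alpha> \<phi> x)"
  using is_weak_deriv_lincomb[OF assms(1) sobolev_is_weak_deriv[OF assms(2,4)]
      smooth_is_weak_deriv[OF assms(1) test_smooth[OF assms(3)]], of 1 "-1"]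
  by simp

lemma sobolev_diff_test:
  assumes "open \<Omega>" "f \<in> sobolev m \<Omega>" "\<phi> \<in> test_functions \<Omega>"
  shows "(\<lambda>x. f x - \<phi> x) \<in> sobolev m \<Omega>"
proof -
  have "f \<in> L2_space \<Omega>" using assms(2) by (simp add: sobolev_def)
  then have "(\<lambda>x. f x - \<phi> x) \<in> L2_space \<Omega>"
    using L2_diff L2_test assms by blast
  moreover have "\<exists>g\<in>L2_space \<Omega>. is_weak_deriv \<Omega> \<alpha> (\<lambda>x. f x - \<phi> x) g" if "ord_mi \<alpha> \<le> m" for \<alpha>
    using is_weak_deriv_diff_test[OF assms that]
      L2_diff[OF sobolev_weak_deriv_L2[OF assms(1,2) that] L2_test[OF assms(1) test_multi_partial[OF assms(3)]]]
    by blast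
  ultimately show ?thesis unfolding sobolev_def by blast
qed

text \<open>Convergence in the Sobolev norm, spelled out as \<open>L\<^sup>2\<close> convergence of each derivative to the weak
  derivative of the limit.\<close>

lemma sobolev0_approximation:
  assumes "open \<Omega>" and f: "f \<in> sobolev0 m \<Omega>"
  obtains \<phi> :: "nat \<Rightarrow> real^2 \<Rightarrow> real" where "\<And>n. \<phi> n \<in> test_functions \<Omega>"
    "\<And>\<alpha>. ord_mi \<alpha> \<le> m \<Longrightarrow>
      (\<lambda>n. L2_norm \<Omega> (\<lambda>x. weak_deriv \<Omega> \<alpha> f x - multi_partial \<alpha> (\<phi> n) x)) \<longlonglongrightarrow> 0"
proof -
  have fm: "f \<in> sobolev m \<Omega>" using f by (simp add: sobolev0_def)
  have "\<exists>\<phi>\<in>test_functions \<Omega>. sobolev_norm m \<Omega> (\<lambda>x. f x - \<phi> x) < inverse (real (Suc n))" for n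
    using f unfolding sobolev0_def by simp
  then obtain \<phi> where \<phi>: "\<And>n. \<phi> n \<in> test_functions \<Omega>"
    "\<And>n. sobolev_norm m \<Omega> (\<lambda>x. f x - \<phi> n x) < inverse (real (Suc n))"
    by metis
  show ?thesis
  proof (rule that[of \<phi>])
    fix \<alpha> assume \<alpha>: "ord_mi \<alpha> \<le> m"
    have le: "L2_norm \<Omega> (\<lambda>x. weak_deriv \<Omega> \<alpha> f x - multi_partial \<alpha> (\<phi> n) x) \<le> inverse (real (Suc n))" for n
    proof -
      have d: "(\<lambda>x. f x - \<phi> n x) \<in> sobolev m \<Omega>"
        by (rule sobolev_diff_test[OF assms(1) fm \<phi>(1)])
      have "L2_norm \<Omega> (\<lambda>x. weak_deriv \<Omega> \<alpha> f x - multi_partial \<alpha> (\<phi> n) x)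
          = L2_norm \<Omega> (weak_deriv \<Omega> \<alpha> (\<lambda>x. f x - \<phi> n x))"
      proof (rule L2_norm_cong_AE[symmetric])
        show "weak_deriv \<Omega> \<alpha> (\<lambda>x. f x - \<phi> n x) \<in> L2_space \<Omega>"
          by (rule sobolev_weak_deriv_L2[OF assms(1) d \<alpha>])
        show "(\<lambda>x. weak_deriv \<Omega> \<alpha> f x - multi_partial \<alpha> (\<phi> n) x) \<in> L2_space \<Omega>"
          by (intro L2_diff sobolev_weak_deriv_L2[OF assms(1) fm \<alpha>] L2_test assms(1) test_multi_partial \<phi>(1))
        show "AE x in lebesgue_on \<Omega>. weak_deriv \<Omega> \<alpha> (\<lambda>x. f x - \<phi> n x) x
            = weak_deriv \<Omega> \<alpha> f x - multi_partial \<alpha> (\<phi> n) x"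
          by (rule weak_deriv_AE_eq[OF assms(1) is_weak_deriv_diff_test[OF assms(1) fm \<phi>(1) \<alpha>]])
      qed
      also have "\<dots> \<le> sobolev_norm m \<Omega> (\<lambda>x. f x - \<phi> n x)"
        by (rule L2_norm_weak_deriv_le[OF assms(1) d \<alpha>])
      finally show ?thesis using \<phi>(2)[of n] by linarith
    qed
    show "(\<lambda>n. L2_norm \<Omega> (\<lambda>x. weak_deriv \<Omega> \<alpha> f x - multi_partial \<alpha> (\<phi> n) x)) \<longlonglongrightarrow> 0"
      by (rule tendsto_sandwich[OF _ _ tendsto_const LIMSEQ_inverse_real_of_nat])
         (intro always_eventually allI le L2_norm_nonneg)+
  qed (rule \<phi>(1))
qed

text \<open>If \<open>f\<close> is a test function, then both inner products equal \<open>(-1)\<^sup>m \<integral> g \<partial>\<^sup>\<alpha>\<^sup>+\<^sup>\<beta> f\<close> by the definition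
  of the weak derivatives of \<open>g\<close>; the general case follows by density.\<close>

lemma sobolev0_exchange_derivatives:
  assumes "open \<Omega>" and f: "f \<in> sobolev0 m \<Omega>" and g: "g \<in> sobolev m \<Omega>"
    and ord: "ord_mi \<alpha> = m" "ord_mi \<beta> = m" "ord_mi \<gamma> = m" "ord_mi \<delta> = m"
    and eq: "\<alpha> + \<beta> = \<gamma> + \<delta>"
  shows "L2_inner \<Omega> (weak_deriv \<Omega> \<alpha> f) (weak_deriv \<Omega> \<beta> g)
    = L2_inner \<Omega> (weak_deriv \<Omega> \<gamma> f) (weak_deriv \<Omega> \<delta> g)"
proof -
  have fm: "f \<in> sobolev m \<Omega>" using f by (simp add: sobolev0_def)
  obtain \<phi> where \<phi>: "\<And>n. \<phi> n \<in> test_functions \<Omega>"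
    "\<And>\<alpha>. ord_mi \<alpha> \<le> m \<Longrightarrow>
      (\<lambda>n. L2_norm \<Omega> (\<lambda>x. weak_deriv \<Omega> \<alpha> f x - multi_partial \<alpha> (\<phi> n) x)) \<longlonglongrightarrow> 0"
    using sobolev0_approximation[OF assms(1) f] by metis
  have lim: "(\<lambda>n. L2_inner \<Omega> (multi_partial \<alpha> (\<phi> n)) (weak_deriv \<Omega> \<beta> g))
      \<longlonglongrightarrow> L2_inner \<Omega> (weak_deriv \<Omega> \<alpha> f) (weak_deriv \<Omega> \<beta> g)"
    if "ord_mi \<alpha> = m" "ord_mi \<beta> = m" for \<alpha> \<beta>
    using that
    by (intro L2_inner_tendsto \<phi>(2) L2_test test_multi_partial \<phi>(1) assms(1)
        sobolev_weak_deriv_L2[OF assms(1) fm] sobolev_weak_deriv_L2[OF assms(1) g]) auto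
  have test: "L2_inner \<Omega> (multi_partial \<alpha> (\<phi> n)) (weak_deriv \<Omega> \<beta> g)
      = (-1) ^ m * (LINT x|lebesgue_on \<Omega>. g x * multi_partial (\<alpha> + \<beta>) (\<phi> n) x)"
    if "ord_mi \<beta> = m" for \<alpha> \<beta> n
  proof -
    have "(LINT x|lebesgue_on \<Omega>. g x * multi_partial \<beta> (multi_partial \<alpha> (\<phi> n)) x)
        = (-1) ^ m * (LINT x|lebesgue_on \<Omega>. weak_deriv \<Omega> \<beta> g x * multi_partial \<alpha> (\<phi> n) x)"
      using sobolev_is_weak_deriv[OF g, of \<beta>] that test_multi_partial[OF \<phi>(1)]
      by (simp add: is_weak_deriv_def)
    then have "(LINT x|lebesgue_on \<Omega>. g x * multi_partial (\<alpha> + \<beta>) (\<phi> n) x)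
        = (-1) ^ m * L2_inner \<Omega> (multi_partial \<alpha> (\<phi> n)) (weak_deriv \<Omega> \<beta> g)"
      by (simp only: multi_partial_multi_partial[OF test_smooth[OF \<phi>(1)]] add.commute[of \<beta> \<alpha>]
          L2_inner_def mult.commute[of "weak_deriv \<Omega> \<beta> g _"])
    then show ?thesis by (simp flip: power_add mult.assoc)
  qed
  have "L2_inner \<Omega> (multi_partial \<alpha> (\<phi> n)) (weak_deriv \<Omega> \<beta> g)
      = L2_inner \<Omega> (multi_partial \<gamma> (\<phi> n)) (weak_deriv \<Omega> \<delta> g)" for n
    by (simp only: test[OF ord(2)] test[OF ord(4)] eq)
  with lim[OF ord(1,2)] lim[OF ord(3,4)] show ?thesis
    using LIMSEQ_unique by simp
qed

text \<open>For a test function, integrating \<open>\<partial>\<^sub>1 (x\<^sub>1 \<phi>\<^sup>2)\<close> gives \<open>\<parallel>\<phi>\<parallel>\<^sup>2 = - 2 \<integral> x\<^sub>1 \<phi> \<partial>\<^sub>1 \<phi>\<close>, and \<open>x\<^sub>1\<close> is bounded on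
  the domain.\<close>

lemma test_Poincare:
  assumes "open \<Omega>" and \<phi>: "\<phi> \<in> test_functions \<Omega>" and R: "\<And>x. x \<in> \<Omega> \<Longrightarrow> \<bar>x $ 1\<bar> \<le> R" "0 \<le> R"
  shows "L2_norm \<Omega> \<phi> \<le> 2 * R * L2_norm \<Omega> (partial 1 \<phi>)"
proof (rule power2_le_imp_le)
  have sm: "smooth \<phi>" by (rule test_smooth[OF \<phi>])
  have sx: "smooth (\<lambda>x. x $ 1 * \<phi> x)" by (intro smooth_mult smooth_coordinate sm)
  have px: "partial 1 (\<lambda>x. x $ 1 * \<phi> x) = (\<lambda>x. x $ 1 * partial 1 \<phi> x + \<phi> x)"
    unfolding smooth_partial_mult[OF smooth_coordinate sm] by (simp add: partial_coordinate)
  have int1: "integrable (lebesgue_on \<Omega>) (\<lambda>x. (x $ 1 * \<phi> x) * partial 1 \<phi> x)"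
    by (intro test_integrable_on test_smooth_mult test_partial \<phi> sx assms(1))
  have int2: "integrable (lebesgue_on \<Omega>) (\<lambda>x. (\<phi> x)\<^sup>2)"
    by (intro L2_square_integrable L2_test assms(1) \<phi>)
  have int3: "integrable (lebesgue_on \<Omega>) (\<lambda>x. (partial 1 \<phi> x)\<^sup>2)"
    by (intro L2_square_integrable L2_test test_partial assms(1) \<phi>)
  have "(LINT x|lebesgue_on \<Omega>. (x $ 1 * \<phi> x) * partial 1 \<phi> x)
      = - (LINT x|lebesgue_on \<Omega>. (x $ 1 * partial 1 \<phi> x + \<phi> x) * \<phi> x)"
    using integration_by_parts[OF assms(1) sx \<phi>] by (simp only: px)
  also have "(\<lambda>x. (x $ 1 * partial 1 \<phi> x + \<phi> x) * \<phi> x) = (\<lambda>x. (x $ 1 * \<phi> x) * partial 1 \<phi> x + (\<phi> x)\<^sup>2)"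
    by (simp add: fun_eq_iff algebra_simps power2_eq_square)
  finally have "(LINT x|lebesgue_on \<Omega>. (\<phi> x)\<^sup>2)
      = (LINT x|lebesgue_on \<Omega>. - 2 * ((x $ 1 * \<phi> x) * partial 1 \<phi> x))"
    using int1 int2 by simp
  also have "\<dots> \<le> (LINT x|lebesgue_on \<Omega>. (\<phi> x)\<^sup>2 / 2 + 2 * R\<^sup>2 * (partial 1 \<phi> x)\<^sup>2)"
  proof (rule integral_mono)
    show "integrable (lebesgue_on \<Omega>) (\<lambda>x. - 2 * ((x $ 1 * \<phi> x) * partial 1 \<phi> x))"
      using int1 by simp
    show "integrable (lebesgue_on \<Omega>) (\<lambda>x. (\<phi> x)\<^sup>2 / 2 + 2 * R\<^sup>2 * (partial 1 \<phi> x)\<^sup>2)"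
      using int2 int3 by simp
    fix x assume "x \<in> space (lebesgue_on \<Omega>)"
    then have "(x $ 1)\<^sup>2 \<le> R\<^sup>2" using R(1)[of x] R(2) by (simp add: abs_le_square_iff[symmetric])
    then have "(x $ 1)\<^sup>2 * (partial 1 \<phi> x)\<^sup>2 \<le> R\<^sup>2 * (partial 1 \<phi> x)\<^sup>2"
      by (rule mult_right_mono) simp
    \<comment> \<open>Young's inequality, weighted so that half of the left-hand side can be absorbed.\<close>
    moreover have "0 \<le> (\<phi> x + 2 * (x $ 1 * partial 1 \<phi> x))\<^sup>2" by simp
    ultimately show "- 2 * ((x $ 1 * \<phi> x) * partial 1 \<phi> x) \<le> (\<phi> x)\<^sup>2 / 2 + 2 * R\<^sup>2 * (partial 1 \<phi> x)\<^sup>2"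
      by (simp add: power2_sum power_mult_distrib field_simps)
  qed
  also have "\<dots> = (LINT x|lebesgue_on \<Omega>. (\<phi> x)\<^sup>2) / 2 + 2 * R\<^sup>2 * (LINT x|lebesgue_on \<Omega>. (partial 1 \<phi> x)\<^sup>2)"
    using int2 int3 by simp
  finally show "(L2_norm \<Omega> \<phi>)\<^sup>2 \<le> (2 * R * L2_norm \<Omega> (partial 1 \<phi>))\<^sup>2"
    by (simp add: L2_norm_square_integral power_mult_distrib)
qed (use R in \<open>simp add: L2_norm_nonneg\<close>)

text \<open>Both sides are continuous along the approximating test functions; the multi-index \<open>(0, 0)\<close> covers
  the function itself.\<close>

lemma sobolev0_Poincare:
  assumes "open \<Omega>" "f \<in> sobolev0 m \<Omega>" "1 \<le> m" "\<And>x. x \<in> \<Omega> \<Longrightarrow> \<bar>x $ 1\<bar> \<le> R" "0 \<le> R"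
  shows "L2_norm \<Omega> f \<le> 2 * R * L2_norm \<Omega> (weak_deriv \<Omega> (1, 0) f)"
proof -
  have fm: "f \<in> sobolev m \<Omega>" using assms(2) by (simp add: sobolev0_def)
  obtain \<phi> where \<phi>: "\<And>n. \<phi> n \<in> test_functions \<Omega>"
    "\<And>\<alpha>. ord_mi \<alpha> \<le> m \<Longrightarrow>
      (\<lambda>n. L2_norm \<Omega> (\<lambda>x. weak_deriv \<Omega> \<alpha> f x - multi_partial \<alpha> (\<phi> n) x)) \<longlonglongrightarrow> 0"
    using sobolev0_approximation[OF assms(1,2)] by metis
  have lim: "(\<lambda>n. L2_norm \<Omega> (multi_partial \<alpha> (\<phi> n))) \<longlonglongrightarrow> L2_norm \<Omega> (weak_deriv \<Omega> \<alpha> f)"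
    if "ord_mi \<alpha> \<le> m" for \<alpha>
    using that
    by (intro L2_norm_tendsto \<phi>(2) L2_test test_multi_partial \<phi>(1) assms(1)
        sobolev_weak_deriv_L2[OF assms(1) fm])
  have f: "L2_norm \<Omega> (weak_deriv \<Omega> (0, 0) f) = L2_norm \<Omega> f"
    by (rule L2_norm_cong_AE[OF sobolev_weak_deriv_L2[OF assms(1) fm] _ sobolev_weak_deriv_zero_order[OF assms(1) fm]])
       (use fm in \<open>auto simp: sobolev_def ord_mi_def\<close>)
  have "(\<lambda>n. L2_norm \<Omega> (\<phi> n)) \<longlonglongrightarrow> L2_norm \<Omega> f"
    using lim[of "(0, 0)"] by (simp add: f multi_partial_def ord_mi_def)
  moreover have "(\<lambda>n. 2 * R * L2_norm \<Omega> (partial 1 (\<phi> n))) \<longlonglongrightarrow> 2 * R * L2_norm \<Omega> (weak_deriv \<Omega> (1, 0) f)"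
    using lim[of "(1, 0)"] assms(3) by (intro tendsto_intros) (simp add: multi_partial_def ord_mi_def)
  ultimately show ?thesis
    by (rule LIMSEQ_le) (use test_Poincare[OF assms(1) \<phi>(1) assms(4,5)] in blast)
qed

section \<open>Korn inequalities and the elastic energy\<close>

definition unit_mi :: "2 \<Rightarrow> multi_index" where
  "unit_mi i = (if i = 1 then (1, 0) else (0, 1))"

text \<open>The quadratic form of the isotropic tensor \<open>C_tensor\<close> evaluated at a matrix.\<close>

definition energy_density :: "real \<Rightarrow> real \<Rightarrow> (2 \<Rightarrow> 2 \<Rightarrow> real) \<Rightarrow> real" where
  "energy_density lam \<mu> e = 2 * \<mu> * (\<Sum>i\<in>UNIV. \<Sum>j\<in>UNIV. (e i j)\<^sup>2) + lam * (\<Sum>i\<in>UNIV. e i i)\<^sup>2"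

lemma C_tensor_energy:
  "(\<Sum>i\<in>UNIV. \<Sum>j\<in>UNIV. (\<Sum>k\<in>UNIV. \<Sum>l\<in>UNIV. C_tensor lam \<mu> i j k l * e k l) * e i j)
    = energy_density lam \<mu> e"
  by (simp add: C_tensor_def kronecker_def energy_density_def sum_2 power2_eq_square algebra_simps)

lemma D_tensor_energy:
  "(\<Sum>i\<in>UNIV. \<Sum>j\<in>UNIV. \<Sum>k\<in>UNIV.
      (\<Sum>l\<in>UNIV. \<Sum>m\<in>UNIV. \<Sum>n\<in>UNIV. D_tensor lam \<mu> \<iota> i j k l m n * \<kappa> l m n) * \<kappa> i j k)
    = \<iota>\<^sup>2 * (\<Sum>i\<in>UNIV. energy_density lam \<mu> (\<kappa> i))"
  by (simp add: D_tensor_def kronecker_def energy_density_def sum_2 power2_eq_square algebra_simps)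

text \<open>The algebra behind the Korn inequality: the last term is the null Lagrangian.\<close>

lemma energy_density_sym:
  "energy_density lam \<mu> (\<lambda>i j. (p i j + p j i) / 2)
    = \<mu> * (\<Sum>i\<in>UNIV. \<Sum>j\<in>UNIV. (p i j)\<^sup>2) + (\<mu> + lam) * (\<Sum>i\<in>UNIV. p i i)\<^sup>2
      + 2 * \<mu> * (p 1 2 * p 2 1 - p 1 1 * p 2 2)"
  by (simp add: energy_density_def sum_2 power2_eq_square field_simps)

lemma L2_component_sum:
  assumes "\<And>i j. p i j \<in> L2_space \<Omega>"
  shows "integrable (lebesgue_on \<Omega>) (\<lambda>x. \<Sum>i\<in>(UNIV::2 set). \<Sum>j\<in>(UNIV::2 set). (p i j x)\<^sup>2)"
    and "(LINT x|lebesgue_on \<Omega>. (\<Sum>i\<in>(UNIV::2 set). \<Sum>j\<in>(UNIV::2 set). (p i j x)\<^sup>2))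
      = (\<Sum>i\<in>UNIV. \<Sum>j\<in>UNIV. (L2_norm \<Omega> (p i j))\<^sup>2)"
  using L2_square_integrable[OF assms] by (simp_all add: L2_norm_square_integral)

text \<open>Integrating \<open>energy_density_sym\<close> leaves \<open>\<mu> G\<close> and a nonnegative multiple of the squared norm of
  the trace \<open>d\<close>.  The companion identity \<open>d\<^sup>2 + c\<^sup>2 = |p|\<^sup>2 - 2 N\<close>, where \<open>c\<close> is the difference of the
  off-diagonal entries, bounds that squared norm by \<open>G\<close>.\<close>

lemma energy_sym_bounds:
  fixes p :: "2 \<Rightarrow> 2 \<Rightarrow> real^2 \<Rightarrow> real"
  assumes p: "\<And>i j. p i j \<in> L2_space \<Omega>"
    and null: "L2_inner \<Omega> (p 1 2) (p 2 1) = L2_inner \<Omega> (p 1 1) (p 2 2)"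
    and "0 \<le> \<mu>" "0 \<le> lam"
  defines "G \<equiv> (\<Sum>i\<in>UNIV. \<Sum>j\<in>UNIV. (L2_norm \<Omega> (p i j))\<^sup>2)"
    and "E \<equiv> (LINT x|lebesgue_on \<Omega>. energy_density lam \<mu> (\<lambda>i j. (p i j x + p j i x) / 2))"
  shows "\<mu> * G \<le> E" and "E \<le> (2 * \<mu> + lam) * G"
    and "integrable (lebesgue_on \<Omega>) (\<lambda>x. energy_density lam \<mu> (\<lambda>i j. (p i j x + p j i x) / 2))"
proof -
  let ?M = "lebesgue_on \<Omega>"
  define d where "d x = (\<Sum>i\<in>UNIV. p i i x)" for x
  define c where "c x = p 1 2 x - p 2 1 x" for x
  define N where "N x = p 1 2 x * p 2 1 x - p 1 1 x * p 2 2 x" for x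
  have dL: "d \<in> L2_space \<Omega>" unfolding d_def sum_2 by (intro L2_add p)
  have cL: "c \<in> L2_space \<Omega>" unfolding c_def by (intro L2_diff p)
  have Ni: "integrable ?M N"
    unfolding N_def by (intro Bochner_Integration.integrable_diff L2_mult_integrable p)
  have N0: "(LINT x|?M. N x) = 0"
    using null unfolding N_def L2_inner_def by (simp add: L2_mult_integrable p)
  have Gi: "integrable ?M (\<lambda>x. \<Sum>i\<in>UNIV. \<Sum>j\<in>UNIV. (p i j x)\<^sup>2)"
    and G: "G = (LINT x|?M. (\<Sum>i\<in>UNIV. \<Sum>j\<in>UNIV. (p i j x)\<^sup>2))"
    unfolding G_def using L2_component_sum[OF p] by simp_all
  have dens: "energy_density lam \<mu> (\<lambda>i j. (p i j x + p j i x) / 2)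
      = \<mu> * (\<Sum>i\<in>UNIV. \<Sum>j\<in>UNIV. (p i j x)\<^sup>2) + (\<mu> + lam) * (d x)\<^sup>2 + 2 * \<mu> * N x" for x
    unfolding energy_density_sym d_def N_def ..
  have E: "E = \<mu> * G + (\<mu> + lam) * (LINT x|?M. (d x)\<^sup>2)"
    unfolding E_def dens G using Gi L2_square_integrable[OF dL] Ni N0 by simp
  show "integrable ?M (\<lambda>x. energy_density lam \<mu> (\<lambda>i j. (p i j x + p j i x) / 2))"
    unfolding dens using Gi L2_square_integrable[OF dL] Ni by simp
  have "(d x)\<^sup>2 = (\<Sum>i\<in>UNIV. \<Sum>j\<in>UNIV. (p i j x)\<^sup>2) - (c x)\<^sup>2 - 2 * N x" for x
    by (simp add: d_def c_def N_def sum_2 power2_eq_square algebra_simps)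
  then have "(LINT x|?M. (d x)\<^sup>2) = G - (LINT x|?M. (c x)\<^sup>2)"
    unfolding G using Gi L2_square_integrable[OF cL] Ni N0 by simp
  moreover have "0 \<le> (LINT x|?M. (c x)\<^sup>2)" "0 \<le> (LINT x|?M. (d x)\<^sup>2)" by simp_all
  ultimately have d: "0 \<le> (LINT x|?M. (d x)\<^sup>2)" "(LINT x|?M. (d x)\<^sup>2) \<le> G" by linarith+
  show "\<mu> * G \<le> E" unfolding E using d(1) assms(3,4) by simp
  have "(\<mu> + lam) * (LINT x|?M. (d x)\<^sup>2) \<le> (\<mu> + lam) * G"
    using d(2) assms(3,4) by (intro mult_left_mono) auto
  then show "E \<le> (2 * \<mu> + lam) * G" unfolding E by (simp add: algebra_simps)
qed

text \<open>The Jacobian of \<open>\<partial>\<^sup>\<kappa> v\<close>.  The form \<open>a(v,v)\<close> is the energy of its symmetric part for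
  \<open>\<kappa> = 0\<close>, plus \<open>\<iota>\<^sup>2\<close> times the energies for the two multi-indices \<open>\<kappa>\<close> of order one.\<close>

definition deriv_jacobian ::
    "(real^2) set \<Rightarrow> multi_index \<Rightarrow> (real^2 \<Rightarrow> real^2) \<Rightarrow> 2 \<Rightarrow> 2 \<Rightarrow> real^2 \<Rightarrow> real" where
  "deriv_jacobian \<Omega> \<kappa> v i j = weak_deriv \<Omega> (unit_mi j + \<kappa>) (component v i)"

lemma ord_unit_mi: "ord_mi (unit_mi j) = 1"
  by (simp add: ord_mi_def unit_mi_def)

lemma deriv_jacobian_L2:
  assumes "open \<Omega>" "\<And>i. component v i \<in> sobolev m \<Omega>" "ord_mi \<kappa> < m"
  shows "deriv_jacobian \<Omega> \<kappa> v i j \<in> L2_space \<Omega>"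
  unfolding deriv_jacobian_def
  by (rule sobolev_weak_deriv_L2[OF assms(1,2)]) (use assms(3) in \<open>simp add: ord_mi_add ord_unit_mi\<close>)

text \<open>The determinant of a Jacobian is a null Lagrangian: both products differentiate the two components
  by multi-indices with the same sum.\<close>

lemma deriv_jacobian_null:
  assumes "open \<Omega>" "\<And>i. component v i \<in> sobolev0 (Suc (ord_mi \<kappa>)) \<Omega>"
  shows "L2_inner \<Omega> (deriv_jacobian \<Omega> \<kappa> v 1 2) (deriv_jacobian \<Omega> \<kappa> v 2 1)
    = L2_inner \<Omega> (deriv_jacobian \<Omega> \<kappa> v 1 1) (deriv_jacobian \<Omega> \<kappa> v 2 2)"
proof -
  have "component v 2 \<in> sobolev (Suc (ord_mi \<kappa>)) \<Omega>"
    using assms(2) by (simp add: sobolev0_def)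
  then show ?thesis
    unfolding deriv_jacobian_def
    by (rule sobolev0_exchange_derivatives[OF assms(1,2)]) (simp_all add: ord_mi_add ord_unit_mi add_ac)
qed

lemma strain_deriv_jacobian:
  "strain \<Omega> v i j x = (deriv_jacobian \<Omega> (0, 0) v i j x + deriv_jacobian \<Omega> (0, 0) v j i x) / 2"
proof -
  have "\<alpha> + (0, 0) = \<alpha>" for \<alpha> :: multi_index by (cases \<alpha>) simp
  then show ?thesis
    by (simp add: strain_def grad_def weak_partial_def deriv_jacobian_def unit_mi_def[symmetric])
qed

text \<open>Differentiating the strain and taking the symmetric part commute: \<open>\<partial>\<^sub>l \<epsilon>(v) = \<epsilon>(\<partial>\<^sub>l v)\<close>.\<close>

lemma strain_grad_deriv_jacobian:
  assumes "open \<Omega>" and v: "\<And>i. component v i \<in> sobolev 2 \<Omega>"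
  shows "AE x in lebesgue_on \<Omega>. strain_grad \<Omega> v l i j x
    = (deriv_jacobian \<Omega> (unit_mi l) v i j x + deriv_jacobian \<Omega> (unit_mi l) v j i x) / 2"
proof -
  have "is_weak_deriv \<Omega> (unit_mi l) (weak_deriv \<Omega> (unit_mi b) (component v a)) (deriv_jacobian \<Omega> (unit_mi l) v a b)" for a b
    using sobolev_weak_deriv_weak_deriv[OF v, of "unit_mi b" "unit_mi l" a]
    by (simp add: ord_unit_mi deriv_jacobian_def add.commute)
  from is_weak_deriv_lincomb[OF assms(1) this[of j i] this[of i j], of "1/2" "1/2"]
  have "is_weak_deriv \<Omega> (unit_mi l) (strain \<Omega> v i j)
     (\<lambda>x. (deriv_jacobian \<Omega> (unit_mi l) v i j x + deriv_jacobian \<Omega> (unit_mi l) v j i x) / 2)"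
    by (simp add: strain_def grad_def weak_partial_def unit_mi_def[symmetric] add_divide_distrib)
  then show ?thesis
    unfolding strain_grad_def weak_partial_def unit_mi_def[symmetric]
    by (rule weak_deriv_AE_eq[OF assms(1)])
qed

lemma a_form_deriv_jacobian:
  assumes "open \<Omega>" and v: "\<And>i. component v i \<in> sobolev0 2 \<Omega>"
    and "0 \<le> \<mu>" "0 \<le> lam"
  shows "a_form lam \<mu> \<iota> \<Omega> v v
    = (LINT x|lebesgue_on \<Omega>. energy_density lam \<mu>
        (\<lambda>i j. (deriv_jacobian \<Omega> (0, 0) v i j x + deriv_jacobian \<Omega> (0, 0) v j i x) / 2))
    + \<iota>\<^sup>2 * (\<Sum>l\<in>UNIV. LINT x|lebesgue_on \<Omega>. energy_density lam \<mu>
        (\<lambda>i j. (deriv_jacobian \<Omega> (unit_mi l) v i j x + deriv_jacobian \<Omega> (unit_mi l) v j i x) / 2))"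
proof -
  let ?e = "\<lambda>l x i j. (deriv_jacobian \<Omega> (unit_mi l) v i j x + deriv_jacobian \<Omega> (unit_mi l) v j i x) / 2"
  have vs: "component v i \<in> sobolev 2 \<Omega>" for i
    using v by (simp add: sobolev0_def)
  have JL: "deriv_jacobian \<Omega> (unit_mi l) v i j \<in> L2_space \<Omega>" for l i j
    by (rule deriv_jacobian_L2[OF assms(1) vs]) (simp add: ord_unit_mi)
  have ae: "AE x in lebesgue_on \<Omega>. strain_grad \<Omega> v l i j x = ?e l x i j" for l i j
    by (rule strain_grad_deriv_jacobian[OF assms(1) vs])
  have eL: "(\<lambda>x. ?e l x i j) \<in> L2_space \<Omega>" for l i j
    using L2_cmult[OF L2_add[OF JL JL], of "1/2"] by simp
  have sL: "strain_grad \<Omega> v l i j \<in> L2_space \<Omega>" for l i j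
    by (rule L2_cong_AE[OF assms(1) eL]) (use ae[of l i j] in eventually_elim, simp)
  note [measurable] = L2_measurable[OF eL] L2_measurable[OF sL]
  have int: "integrable (lebesgue_on \<Omega>) (\<lambda>x. energy_density lam \<mu> (?e l x))" for l
    by (rule energy_sym_bounds(3)[OF JL deriv_jacobian_null[OF assms(1)] assms(3,4)])
       (use v in \<open>simp add: ord_unit_mi numeral_2_eq_2\<close>)
  have "(LINT x|lebesgue_on \<Omega>. \<iota>\<^sup>2 * (\<Sum>l\<in>UNIV. energy_density lam \<mu> (\<lambda>i j. strain_grad \<Omega> v l i j x)))
      = (LINT x|lebesgue_on \<Omega>. \<iota>\<^sup>2 * (\<Sum>l\<in>UNIV. energy_density lam \<mu> (?e l x)))"
  proof (rule integral_cong_AE)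
    show "(\<lambda>x. \<iota>\<^sup>2 * (\<Sum>l\<in>UNIV. energy_density lam \<mu> (\<lambda>i j. strain_grad \<Omega> v l i j x))) \<in> borel_measurable (lebesgue_on \<Omega>)"
      unfolding energy_density_def by measurable
    show "(\<lambda>x. \<iota>\<^sup>2 * (\<Sum>l\<in>UNIV. energy_density lam \<mu> (?e l x))) \<in> borel_measurable (lebesgue_on \<Omega>)"
      unfolding energy_density_def by measurable
    have "AE x in lebesgue_on \<Omega>. \<forall>l i j. strain_grad \<Omega> v l i j x = ?e l x i j"
      using ae by (simp add: AE_all_countable)
    then show "AE x in lebesgue_on \<Omega>. \<iota>\<^sup>2 * (\<Sum>l\<in>UNIV. energy_density lam \<mu> (\<lambda>i j. strain_grad \<Omega> v l i j x))
        = \<iota>\<^sup>2 * (\<Sum>l\<in>UNIV. energy_density lam \<mu> (?e l x))"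
      by eventually_elim (simp only:)
  qed
  also have "\<dots> = \<iota>\<^sup>2 * (\<Sum>l\<in>UNIV. LINT x|lebesgue_on \<Omega>. energy_density lam \<mu> (?e l x))"
    using int by simp
  finally show ?thesis
    unfolding a_form_def C_tensor_energy D_tensor_energy strain_deriv_jacobian by simp
qed

lemma sobolev0_mono: "k \<le> m \<Longrightarrow> sobolev0 m \<Omega> \<subseteq> sobolev0 k \<Omega>"
proof
  fix f assume km: "k \<le> m" and f: "f \<in> sobolev0 m \<Omega>"
  have le: "sobolev_norm k \<Omega> g \<le> sobolev_norm m \<Omega> g" for g
    unfolding sobolev_norm_def using km by (auto intro!: sum_mono2)
  have "f \<in> sobolev k \<Omega>"
    using f km unfolding sobolev0_def sobolev_def by fastforce
  moreover have "\<exists>\<phi>\<in>test_functions \<Omega>. sobolev_norm k \<Omega> (\<lambda>x. f x - \<phi> x) < e" if "0 < e" for e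
  proof -
    have "\<exists>\<phi>\<in>test_functions \<Omega>. sobolev_norm m \<Omega> (\<lambda>x. f x - \<phi> x) < e"
      using f that by (simp add: sobolev0_def)
    then obtain \<phi> where "\<phi> \<in> test_functions \<Omega>" "sobolev_norm m \<Omega> (\<lambda>x. f x - \<phi> x) < e"
      by (rule bexE)
    then show ?thesis using le[of "\<lambda>x. f x - \<phi> x"] by (intro bexI[of _ \<phi>]) auto
  qed
  ultimately show "f \<in> sobolev0 k \<Omega>" by (simp add: sobolev0_def)
qed

lemma ord_mi_0: "{\<alpha>. ord_mi \<alpha> = 0} = {(0, 0)}"
  by (auto simp: ord_mi_def)

lemma ord_mi_1: "{\<alpha>. ord_mi \<alpha> = 1} = {unit_mi 1, unit_mi 2}"
proof -
  have split: "a + b = 1 \<longleftrightarrow> a = 1 \<and> b = 0 \<or> a = 0 \<and> b = 1" for a b :: nat by arith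
  have unit: "unit_mi 1 = (1, 0)" "unit_mi 2 = (0, 1)" by (simp_all add: unit_mi_def)
  show ?thesis by (rule set_eqI) (simp only: ord_mi_def split unit mem_Collect_eq insert_iff empty_iff prod_eq_iff fst_conv snd_conv simp_thms)
qed

lemma ord_mi_2: "{\<alpha>. ord_mi \<alpha> = 2} = {(2, 0), (1, 1), (0, 2)}"
proof -
  have split: "a + b = 2 \<longleftrightarrow> a = 2 \<and> b = 0 \<or> a = 1 \<and> b = 1 \<or> a = 0 \<and> b = 2" for a b :: nat by arith
  show ?thesis by (rule set_eqI) (simp only: ord_mi_def split mem_Collect_eq insert_iff empty_iff prod_eq_iff fst_conv snd_conv simp_thms)
qed

lemma L2_norm_vector:
  assumes "\<And>i. component v i \<in> L2_space \<Omega>"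
  shows "(LINT x|lebesgue_on \<Omega>. (norm (v x))\<^sup>2) = (\<Sum>i\<in>UNIV. (L2_norm \<Omega> (component v i))\<^sup>2)"
  using L2_square_integrable[OF assms]
  by (simp add: power2_norm_eq_inner inner_vec_def L2_norm_square_integral power2_eq_square[symmetric])

lemma grad_L2_norm_sum:
  assumes "open \<Omega>" "\<And>i. component v i \<in> sobolev m \<Omega>" "1 \<le> m"
  shows "(LINT x|lebesgue_on \<Omega>. (\<Sum>i\<in>UNIV. \<Sum>j\<in>UNIV. (grad \<Omega> v i j x)\<^sup>2))
    = (\<Sum>i\<in>UNIV. \<Sum>j\<in>UNIV. (L2_norm \<Omega> (weak_deriv \<Omega> (unit_mi j) (component v i)))\<^sup>2)"
  unfolding grad_def weak_partial_def unit_mi_def[symmetric]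
  by (rule L2_component_sum(2)) (use assms in \<open>auto intro!: sobolev_weak_deriv_L2 simp: ord_unit_mi\<close>)

lemma sobolev_norm_1_square:
  assumes "open \<Omega>" "f \<in> sobolev m \<Omega>" "1 \<le> m"
  shows "(sobolev_norm 1 \<Omega> f)\<^sup>2
    = (L2_norm \<Omega> f)\<^sup>2 + (\<Sum>j\<in>UNIV. (L2_norm \<Omega> (weak_deriv \<Omega> (unit_mi j) f))\<^sup>2)"
proof -
  have "L2_norm \<Omega> (weak_deriv \<Omega> (0, 0) f) = L2_norm \<Omega> f"
    by (rule L2_norm_cong_AE[OF sobolev_weak_deriv_L2[OF assms(1,2)] _ sobolev_weak_deriv_zero_order[OF assms(1,2)]])
       (use assms(2) in \<open>auto simp: sobolev_def ord_mi_def\<close>)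
  moreover have "{..1::nat} = {0, 1}" by auto
  moreover have "unit_mi 1 \<noteq> unit_mi 2" by (simp add: unit_mi_def)
  ultimately show ?thesis
    using assms(3) unfolding sobolev_norm_square
    by (simp add: sobolev_seminorm_square[OF assms(1,2)] ord_mi_0 ord_mi_1[unfolded One_nat_def] sum_2)
qed

text \<open>The full second gradient counts the mixed derivative twice.  Since its squared norm \<open>M\<close> equals
  \<open>\<integral> \<partial>\<^sub>1\<partial>\<^sub>1f \<partial>\<^sub>2\<partial>\<^sub>2f\<close>, twice \<open>M\<close> is at most the sum of the squared norms of the two pure derivatives, so
  \<open>M\<close> is at most a third of the squared seminorm.\<close>

lemma sobolev0_second_derivatives:
  assumes "open \<Omega>" "f \<in> sobolev0 2 \<Omega>"
  defines "F \<equiv> (\<Sum>l\<in>UNIV. \<Sum>j\<in>UNIV. (L2_norm \<Omega> (weak_deriv \<Omega> (unit_mi j + unit_mi l) f))\<^sup>2)"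
  shows "(sobolev_seminorm 2 \<Omega> f)\<^sup>2 \<le> F" and "3 * F \<le> 4 * (sobolev_seminorm 2 \<Omega> f)\<^sup>2"
proof -
  have fs: "f \<in> sobolev 2 \<Omega>" using assms(2) by (simp add: sobolev0_def)
  define D where "D \<alpha> = weak_deriv \<Omega> \<alpha> f" for \<alpha>
  have DL: "D \<alpha> \<in> L2_space \<Omega>" if "ord_mi \<alpha> = 2" for \<alpha>
    unfolding D_def using that by (intro sobolev_weak_deriv_L2[OF assms(1) fs]) simp
  have S: "(sobolev_seminorm 2 \<Omega> f)\<^sup>2 = (L2_norm \<Omega> (D (2, 0)))\<^sup>2 + (L2_norm \<Omega> (D (1, 1)))\<^sup>2 + (L2_norm \<Omega> (D (0, 2)))\<^sup>2"
    by (simp add: sobolev_seminorm_square[OF assms(1) fs] ord_mi_2 D_def)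
  have F: "F = (L2_norm \<Omega> (D (2, 0)))\<^sup>2 + 2 * (L2_norm \<Omega> (D (1, 1)))\<^sup>2 + (L2_norm \<Omega> (D (0, 2)))\<^sup>2"
    by (simp add: F_def sum_2 unit_mi_def D_def numeral_2_eq_2)
  show "(sobolev_seminorm 2 \<Omega> f)\<^sup>2 \<le> F" by (simp add: S F)
  have "(L2_norm \<Omega> (D (1, 1)))\<^sup>2 = L2_inner \<Omega> (D (2, 0)) (D (0, 2))"
    unfolding L2_norm_square D_def
    by (rule sobolev0_exchange_derivatives[OF assms(1,2) fs]) (simp_all add: ord_mi_def)
  also have "\<dots> \<le> L2_norm \<Omega> (D (2, 0)) * L2_norm \<Omega> (D (0, 2))"
    using L2_Cauchy_Schwarz[OF DL DL, of "(2, 0)" "(0, 2)"] by (simp add: ord_mi_def)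
  finally have "2 * (L2_norm \<Omega> (D (1, 1)))\<^sup>2 \<le> (L2_norm \<Omega> (D (2, 0)))\<^sup>2 + (L2_norm \<Omega> (D (0, 2)))\<^sup>2"
    using sum_squares_bound[of "L2_norm \<Omega> (D (2, 0))" "L2_norm \<Omega> (D (0, 2))"] by linarith
  then show "3 * F \<le> 4 * (sobolev_seminorm 2 \<Omega> f)\<^sup>2" by (simp add: S F)
qed

lemma bounded_poincare_const:
  assumes "open \<Omega>" "bounded \<Omega>"
  shows "\<exists>Cp>0. poincare_const \<Omega> Cp"
proof -
  obtain R where R: "0 < R" "\<And>x. x \<in> \<Omega> \<Longrightarrow> norm x \<le> R"
    using assms(2) by (auto simp: bounded_pos)
  have R1: "\<bar>x $ 1\<bar> \<le> R" if "x \<in> \<Omega>" for x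
    using R(2)[OF that] component_le_norm_cart[of x 1] by linarith
  have "poincare_const \<Omega> (2 * R)"
    unfolding poincare_const_def
  proof
    fix v assume "v \<in> sobolev0_vec 1 \<Omega>"
    then have v0: "\<And>i. component v i \<in> sobolev0 1 \<Omega>" by (simp add: sobolev0_vec_def)
    then have v: "\<And>i. component v i \<in> sobolev 1 \<Omega>" by (simp add: sobolev0_def)
    then have vL: "\<And>i. component v i \<in> L2_space \<Omega>" by (simp add: sobolev_def)
    have u1: "unit_mi 1 = (1, 0)" by (simp add: unit_mi_def)
    have comp: "(L2_norm \<Omega> (component v i))\<^sup>2
        \<le> (2 * R)\<^sup>2 * (\<Sum>j\<in>UNIV. (L2_norm \<Omega> (weak_deriv \<Omega> (unit_mi j) (component v i)))\<^sup>2)" for i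
    proof -
      have "(L2_norm \<Omega> (component v i))\<^sup>2 \<le> (2 * R * L2_norm \<Omega> (weak_deriv \<Omega> (1, 0) (component v i)))\<^sup>2"
        using sobolev0_Poincare[OF assms(1) v0 _ R1] R(1) by (intro power_mono L2_norm_nonneg) auto
      also have "\<dots> \<le> (2 * R)\<^sup>2 * (\<Sum>j\<in>UNIV. (L2_norm \<Omega> (weak_deriv \<Omega> (unit_mi j) (component v i)))\<^sup>2)"
        unfolding power_mult_distrib[of "2 * R"] by (intro mult_left_mono) (simp_all add: sum_2 u1)
      finally show ?thesis .
    qed
    have "sqrt (LINT x|lebesgue_on \<Omega>. (norm (v x))\<^sup>2)
        \<le> sqrt ((2 * R)\<^sup>2 * (LINT x|lebesgue_on \<Omega>. (\<Sum>i\<in>UNIV. \<Sum>j\<in>UNIV. (grad \<Omega> v i j x)\<^sup>2)))"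
      unfolding L2_norm_vector[OF vL] grad_L2_norm_sum[OF assms(1) v order_refl] sum_distrib_left[of "(2 * R)\<^sup>2"]
      using comp unfolding sum_distrib_left by (intro real_sqrt_le_mono sum_mono)
    then show "sqrt (LINT x|lebesgue_on \<Omega>. (norm (v x))\<^sup>2)
        \<le> 2 * R * sqrt (LINT x|lebesgue_on \<Omega>. (\<Sum>i\<in>UNIV. \<Sum>j\<in>UNIV. (grad \<Omega> v i j x)\<^sup>2))"
      using R(1) by (simp add: real_sqrt_mult)
  qed
  with R(1) show ?thesis by (intro exI[of _ "2 * R"]) simp
qed

text \<open>Here \<open>L\<close> and \<open>G (0, 0)\<close> are the squared norms of \<open>v\<close> and \<open>\<nabla>v\<close>, while \<open>F\<close> and \<open>S\<close> measure the second
  derivatives with the mixed ones counted twice and once, respectively.\<close>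

lemma a_form_bounds:
  fixes \<iota> :: real
  assumes "open \<Omega>" and v0: "v \<in> sobolev0_vec 2 \<Omega>"
    and Cp: "poincare_const \<Omega> Cp" and \<mu>: "0 < \<mu>" and lam: "0 \<le> lam"
  defines "H \<equiv> (sobolev_norm_vec 1 \<Omega> v)\<^sup>2 + \<iota>\<^sup>2 * (sobolev_seminorm_vec 2 \<Omega> v)\<^sup>2"
  shows "\<mu> / (1 + Cp\<^sup>2) * H \<le> a_form lam \<mu> \<iota> \<Omega> v v"
    and "\<mu> \<le> lam \<Longrightarrow> a_form lam \<mu> \<iota> \<Omega> v v \<le> 2 * (lam + \<mu>) * H"
proof -
  have v2: "component v i \<in> sobolev0 2 \<Omega>" for i using v0 by (simp add: sobolev0_vec_def)
  have v1: "component v i \<in> sobolev0 1 \<Omega>" for i using v2 sobolev0_mono[of 1 2 \<Omega>] by auto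
  have vs: "component v i \<in> sobolev 2 \<Omega>" for i using v2 by (simp add: sobolev0_def)
  have vL: "component v i \<in> L2_space \<Omega>" for i using vs[of i] by (simp add: sobolev_def)
  define G where "G \<kappa> = (\<Sum>i\<in>UNIV. \<Sum>j\<in>UNIV. (L2_norm \<Omega> (deriv_jacobian \<Omega> \<kappa> v i j))\<^sup>2)" for \<kappa>
  define E where "E \<kappa> = (LINT x|lebesgue_on \<Omega>. energy_density lam \<mu>
        (\<lambda>i j. (deriv_jacobian \<Omega> \<kappa> v i j x + deriv_jacobian \<Omega> \<kappa> v j i x) / 2))" for \<kappa>
  define F where "F = (\<Sum>l\<in>UNIV. G (unit_mi l))"
  define L where "L = (\<Sum>i\<in>UNIV. (L2_norm \<Omega> (component v i))\<^sup>2)"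
  define S where "S = (sobolev_seminorm_vec 2 \<Omega> v)\<^sup>2"
  have EG: "\<mu> * G \<kappa> \<le> E \<kappa> \<and> E \<kappa> \<le> (2 * \<mu> + lam) * G \<kappa>" if "ord_mi \<kappa> < 2" for \<kappa>
  proof -
    have "ord_mi \<kappa> = 0 \<or> ord_mi \<kappa> = 1" using that by auto
    then have "component v i \<in> sobolev0 (Suc (ord_mi \<kappa>)) \<Omega>" for i
      using v1 v2 by (auto simp: numeral_2_eq_2)
    then show ?thesis
      unfolding G_def E_def using \<mu> lam
      by (intro conjI energy_sym_bounds(1,2) deriv_jacobian_L2[OF assms(1) vs that] deriv_jacobian_null assms(1)) auto
  qed
  have a: "a_form lam \<mu> \<iota> \<Omega> v v = E (0, 0) + \<iota>\<^sup>2 * (\<Sum>l\<in>UNIV. E (unit_mi l))"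
    unfolding E_def using \<mu> lam by (intro a_form_deriv_jacobian assms(1) v2) auto
  have E0: "\<mu> * G (0, 0) \<le> E (0, 0)" "E (0, 0) \<le> (2 * \<mu> + lam) * G (0, 0)"
    using EG[of "(0, 0)"] by (auto simp: ord_mi_def)
  have E1: "\<mu> * F \<le> (\<Sum>l\<in>UNIV. E (unit_mi l))" "(\<Sum>l\<in>UNIV. E (unit_mi l)) \<le> (2 * \<mu> + lam) * F"
    unfolding F_def sum_distrib_left by (rule sum_mono; simp add: EG ord_unit_mi)+
  have zero: "\<alpha> + (0, 0) = \<alpha>" for \<alpha> :: multi_index by (cases \<alpha>) simp
  have G0: "G (0, 0) = (\<Sum>i\<in>UNIV. \<Sum>j\<in>UNIV. (L2_norm \<Omega> (weak_deriv \<Omega> (unit_mi j) (component v i)))\<^sup>2)"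
    by (simp add: G_def deriv_jacobian_def zero)
  have norm1: "(sobolev_norm_vec 1 \<Omega> v)\<^sup>2 = L + G (0, 0)"
  proof -
    have "(sobolev_norm_vec 1 \<Omega> v)\<^sup>2 = (\<Sum>i\<in>UNIV. (sobolev_norm 1 \<Omega> (component v i))\<^sup>2)"
      by (simp add: sobolev_norm_vec_def sum_nonneg)
    then show ?thesis
      by (simp only: sobolev_norm_1_square[OF assms(1) vs one_le_numeral] L_def G0 sum.distrib)
  qed
  have H: "H = L + G (0, 0) + \<iota>\<^sup>2 * S" unfolding H_def norm1 S_def ..
  have S: "S = (\<Sum>i\<in>UNIV. (sobolev_seminorm 2 \<Omega> (component v i))\<^sup>2)"
    unfolding S_def sobolev_seminorm_vec_def by (subst real_sqrt_pow2) (auto intro!: sum_nonneg)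
  have F: "F = (\<Sum>i\<in>UNIV. \<Sum>l\<in>UNIV. \<Sum>j\<in>UNIV. (L2_norm \<Omega> (weak_deriv \<Omega> (unit_mi j + unit_mi l) (component v i)))\<^sup>2)"
    unfolding F_def G_def deriv_jacobian_def by (rule sum.swap)
  have SF: "S \<le> F" "3 * F \<le> 4 * S"
    unfolding S F sum_distrib_left
    by (intro sum_mono sobolev0_second_derivatives[OF assms(1) v2, unfolded sum_distrib_left])+
  have pos: "0 \<le> L" "0 \<le> G (0, 0)" "0 \<le> S"
    by (auto simp: L_def G_def S intro!: sum_nonneg)
  have "sqrt L \<le> Cp * sqrt (G (0, 0))"
    using Cp v1 unfolding poincare_const_def sobolev0_vec_def L_def G0
    by (auto simp: L2_norm_vector[OF vL, symmetric] grad_L2_norm_sum[OF assms(1) vs, symmetric])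
  then have "(sqrt L)\<^sup>2 \<le> (Cp * sqrt (G (0, 0)))\<^sup>2"
    using pos by (intro power_mono) auto
  then have LG: "L \<le> Cp\<^sup>2 * G (0, 0)"
    using pos by (simp add: power_mult_distrib)
  show "\<mu> / (1 + Cp\<^sup>2) * H \<le> a_form lam \<mu> \<iota> \<Omega> v v"
  proof -
    have c: "0 < 1 + Cp\<^sup>2" by (simp add: add_pos_nonneg)
    have "H \<le> (1 + Cp\<^sup>2) * (G (0, 0) + \<iota>\<^sup>2 * F)"
    proof -
      have "\<iota>\<^sup>2 * S \<le> \<iota>\<^sup>2 * F" using SF(1) by (rule mult_left_mono) simp
      moreover have "0 \<le> Cp\<^sup>2 * (\<iota>\<^sup>2 * F)" using SF(1) pos(3) by simp
      ultimately show ?thesis using LG unfolding H by (simp add: algebra_simps)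
    qed
    then have "\<mu> / (1 + Cp\<^sup>2) * H \<le> \<mu> * (G (0, 0) + \<iota>\<^sup>2 * F)"
      using c \<mu> by (simp add: divide_le_eq mult_ac)
    also have "\<dots> \<le> a_form lam \<mu> \<iota> \<Omega> v v"
      using E0(1) mult_left_mono[OF E1(1), of "\<iota>\<^sup>2"] unfolding a by (simp add: algebra_simps)
    finally show ?thesis .
  qed
  show "a_form lam \<mu> \<iota> \<Omega> v v \<le> 2 * (lam + \<mu>) * H" if "\<mu> \<le> lam"
  proof -
    \<comment> \<open>The assumption \<open>\<mu> \<le> \<lambda>\<close> is used for \<open>4 (2\<mu> + \<lambda>) \<le> 6 (\<lambda> + \<mu>)\<close>.\<close>
    have "(2 * \<mu> + lam) * (3 * F) \<le> (2 * \<mu> + lam) * (4 * S)"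
      using SF(2) \<mu> lam by (intro mult_left_mono) auto
    also have "\<dots> \<le> 6 * (lam + \<mu>) * S"
      using mult_right_mono[of "4 * (2 * \<mu> + lam)" "6 * (lam + \<mu>)" S] that pos(3)
      by (simp add: mult_ac)
    finally have "(2 * \<mu> + lam) * F \<le> 2 * (lam + \<mu>) * S" by (simp add: algebra_simps)
    with E1(2) have 2: "\<iota>\<^sup>2 * (\<Sum>l\<in>UNIV. E (unit_mi l)) \<le> \<iota>\<^sup>2 * (2 * (lam + \<mu>) * S)"
      by (intro mult_left_mono) auto
    have "(2 * \<mu> + lam) * G (0, 0) \<le> 2 * (lam + \<mu>) * (L + G (0, 0))"
      using pos \<mu> lam by (intro mult_mono) auto
    with E0(2) 2 show ?thesis unfolding a H by (simp add: algebra_simps)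
  qed
qed

theorem theorem1:
  shows "\<exists>C :: real \<Rightarrow> real \<Rightarrow> real.
    (\<forall>\<mu> Cp. 0 < \<mu> \<longrightarrow> 0 < Cp \<longrightarrow> 0 < C \<mu> Cp) \<and>
    (\<forall>\<Omega>. bounded_polygon \<Omega> \<longrightarrow>
      (\<exists>Cp>0. poincare_const \<Omega> Cp) \<and>
      (\<forall>Cp lam \<mu> \<iota>. \<forall>v\<in>sobolev0_vec 2 \<Omega>.
        0 < Cp \<longrightarrow> poincare_const \<Omega> Cp \<longrightarrow> 0 < \<mu> \<longrightarrow> 0 \<le> lam \<longrightarrow> 0 < \<iota> \<longrightarrow> \<iota> \<le> 1 \<longrightarrow>
          C \<mu> Cp * ((sobolev_norm_vec 1 \<Omega> v)\<^sup>2 + \<iota>\<^sup>2 * (sobolev_seminorm_vec 2 \<Omega> v)\<^sup>2)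
            \<le> a_form lam \<mu> \<iota> \<Omega> v v \<and>
          (\<mu> \<le> lam \<longrightarrow>
            a_form lam \<mu> \<iota> \<Omega> v v
              \<le> 2 * (lam + \<mu>) *
                 ((sobolev_norm_vec 1 \<Omega> v)\<^sup>2 + \<iota>\<^sup>2 * (sobolev_seminorm_vec 2 \<Omega> v)\<^sup>2))))"
proof (rule exI[of _ "\<lambda>\<mu> Cp. \<mu> / (1 + Cp\<^sup>2)"], intro conjI allI impI ballI)
  show "0 < \<mu> / (1 + Cp\<^sup>2)" if "0 < \<mu>" for \<mu> Cp :: real
    using that by (simp add: add_pos_nonneg)
  fix \<Omega> assume "bounded_polygon \<Omega>"
  then have \<Omega>: "open \<Omega>" "bounded \<Omega>" by (auto simp: bounded_polygon_def)
  show "\<exists>Cp>0. poincare_const \<Omega> Cp" by (rule bounded_poincare_const[OF \<Omega>])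
  fix Cp lam \<mu> \<iota> v
  assume "v \<in> sobolev0_vec 2 \<Omega>" "poincare_const \<Omega> Cp" "0 < (\<mu>::real)" "0 \<le> (lam::real)"
  note bounds = a_form_bounds[OF \<Omega>(1) this]
  show "\<mu> / (1 + Cp\<^sup>2) * ((sobolev_norm_vec 1 \<Omega> v)\<^sup>2 + \<iota>\<^sup>2 * (sobolev_seminorm_vec 2 \<Omega> v)\<^sup>2)
      \<le> a_form lam \<mu> \<iota> \<Omega> v v" by (rule bounds(1))
  show "a_form lam \<mu> \<iota> \<Omega> v v
      \<le> 2 * (lam + \<mu>) * ((sobolev_norm_vec 1 \<Omega> v)\<^sup>2 + \<iota>\<^sup>2 * (sobolev_seminorm_vec 2 \<Omega> v)\<^sup>2)" if "\<mu> \<le> lam"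
    using that by (rule bounds(2))
qed

end
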